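(* Let $\sigma_x\ge 0$ and $\sigma_y>0$, and let $$L=(x^2-y^2)\partial_x+2xy\,\partial_y+\sigma_x\partial_{xx}+\sigma_y\partial_{yy}$$ be the generator of the stochastic differential equation $dX_t=(X_t^2-Y_t^2)\,dt+\sqrt{2\sigma_x}\,dW^{(1)}_t$, $dY_t=2X_tY_t\,dt+\sqrt{2\sigma_y}\,dW^{(2)}_t$ on $\mathbb{R}^2$. Then there exists a $C^2$ function $V:\mathbb{R}^2\to(0,\infty)$ which is a (global) super Lyapunov function for this dynamics. More exactly, for every $\delta\in(0,\tfrac25)$ the super Lyapunov function $V$ can be chosen to have exponent $\gamma=\frac{5\delta+5}{5\delta+3}$ and to satisfy, for some positive constants $c$ and $C$, $$c\,|(x,y)|^{\delta}\le V(x,y)\le C\,|(x,y)|^{\frac52\delta+\frac32}\qquad\text{for all }(x,y)\in\mathbb{R}^2\text{ with }|(x,y)|\ge 1 .$$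
   Context: $W^{(1)},W^{(2)}$ are independent standard one-dimensional Brownian motions and $|\cdot|$ is the Euclidean norm. A $C^2$ function $V:\mathbb{R}^2\to(0,\infty)$ is a (global) Lyapunov function with exponent $\gamma>0$ for the generator $L$ if (1) $V(x,y)\to\infty$ as $|(x,y)|\to\infty$, and (2) there are constants $m,b>0$ such that $(LV)(x,y)\le -m\,V(x,y)^{\gamma}+b$ for all $(x,y)\in\mathbb{R}^2$. It is called a super Lyapunov function if $\gamma>1$. *)

theory Defs
  imports "HOL-Analysis.Analysis"
begin

text \<open>The plane is \<open>real \<times> real\<close>, whose library norm is the Euclidean one
  (\<open>norm_Pair\<close>). Since \<open>deriv\<close> is total, differentiability is always required
  separately, in \<open>C1\<close> below.\<close>

definition partial_x :: "(real \<times> real \<Rightarrow> real) \<Rightarrow> real \<times> real \<Rightarrow> real" where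
  "partial_x f p = deriv (\<lambda>t. f (t, snd p)) (fst p)"

definition partial_y :: "(real \<times> real \<Rightarrow> real) \<Rightarrow> real \<times> real \<Rightarrow> real" where
  "partial_y f p = deriv (\<lambda>t. f (fst p, t)) (snd p)"

definition C1 :: "(real \<times> real \<Rightarrow> real) \<Rightarrow> bool" where
  "C1 f \<longleftrightarrow>
     (\<forall>x y. (\<lambda>t. f (t, y)) differentiable (at x)) \<and>
     (\<forall>x y. (\<lambda>t. f (x, t)) differentiable (at y)) \<and>
     continuous_on UNIV (partial_x f) \<and> continuous_on UNIV (partial_y f)"

definition C2 :: "(real \<times> real \<Rightarrow> real) \<Rightarrow> bool" where
  "C2 f \<longleftrightarrow> C1 f \<and> C1 (partial_x f) \<and> C1 (partial_y f)"

definition L :: "real \<Rightarrow> real \<Rightarrow> (real \<times> real \<Rightarrow> real) \<Rightarrow> real \<times> real \<Rightarrow> real" where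
  "L \<sigma>x \<sigma>y f = (\<lambda>(x, y).
     (x\<^sup>2 - y\<^sup>2) * partial_x f (x, y) + 2 * x * y * partial_y f (x, y)
     + \<sigma>x * partial_x (partial_x f) (x, y) + \<sigma>y * partial_y (partial_y f) (x, y))"

text \<open>The generator of the planar Ito equation
  \<open>dZ = b(Z) dt + s1(Z) dW1 + s2(Z) dW2\<close> with independent standard Brownian
  motions \<open>W1\<close>, \<open>W2\<close>, that is, \<open>b \<cdot> \<nabla>f + tr (S S\<^sup>T D\<^sup>2f) / 2\<close> where \<open>S\<close> has
  columns \<open>s1\<close> and \<open>s2\<close>. It serves only to relate \<open>L\<close> to its equation.\<close>

definition ito_generator ::
  "(real \<times> real \<Rightarrow> real \<times> real) \<Rightarrow> (real \<times> real \<Rightarrow> real \<times> real) \<Rightarrow> (real \<times> real \<Rightarrow> real \<times> real) \<Rightarrow>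
   (real \<times> real \<Rightarrow> real) \<Rightarrow> real \<times> real \<Rightarrow> real" where
  "ito_generator b s1 s2 f p =
     fst (b p) * partial_x f p + snd (b p) * partial_y f p
     + (((fst (s1 p))\<^sup>2 + (fst (s2 p))\<^sup>2) * partial_x (partial_x f) p
        + (fst (s1 p) * snd (s1 p) + fst (s2 p) * snd (s2 p))
          * (partial_x (partial_y f) p + partial_y (partial_x f) p)
        + ((snd (s1 p))\<^sup>2 + (snd (s2 p))\<^sup>2) * partial_y (partial_y f) p) / 2"

lemma L_eq_ito_generator:
  assumes "\<sigma>x \<ge> 0" "\<sigma>y \<ge> 0"
  shows "L \<sigma>x \<sigma>y =
    ito_generator (\<lambda>(x, y). (x\<^sup>2 - y\<^sup>2, 2 * x * y))
      (\<lambda>_. (sqrt (2 * \<sigma>x), 0)) (\<lambda>_. (0, sqrt (2 * \<sigma>y)))"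
  using assms by (auto simp: fun_eq_iff L_def ito_generator_def field_simps)

text \<open>The generator is an arbitrary operator \<open>A\<close>. The real power \<open>V p powr \<gamma>\<close> is
  taken of a positive number.\<close>

definition lyapunov_function ::
  "((real \<times> real \<Rightarrow> real) \<Rightarrow> real \<times> real \<Rightarrow> real) \<Rightarrow> real \<Rightarrow> (real \<times> real \<Rightarrow> real) \<Rightarrow> bool" where
  "lyapunov_function A \<gamma> V \<longleftrightarrow>
     \<gamma> > 0 \<and> C2 V \<and> (\<forall>p. V p > 0) \<and>
     filterlim V at_top at_infinity \<and>
     (\<exists>m b. m > 0 \<and> b > 0 \<and> (\<forall>p. A V p \<le> - m * V p powr \<gamma> + b))"

definition super_lyapunov_function ::
  "((real \<times> real \<Rightarrow> real) \<Rightarrow> real \<times> real \<Rightarrow> real) \<Rightarrow> real \<Rightarrow> (real \<times> real \<Rightarrow> real) \<Rightarrow> bool" where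
  "super_lyapunov_function A \<gamma> V \<longleftrightarrow> lyapunov_function A \<gamma> V \<and> \<gamma> > 1"

end

theory Submission
  imports Defs "HOL-Real_Asymp.Real_Asymp"
begin

text \<open>Write \<open>r = |(x, y)|\<close>, \<open>N = r\<^sup>2 (r - x)\<close>, and \<open>T\<close> for the first-order part of \<open>L\<close>. In the
  coordinate \<open>w = 1 / (x + i y)\<close> the drift is the translation \<open>w' = - 1\<close>, and
  \<open>|w| - Re w = (r - x) / r\<^sup>2\<close> satisfies \<open>T ((r - x) / r\<^sup>2) = r (r - x) / r\<^sup>2\<close>. So a negative power
  \<open>-k\<close> of it decays along the flow at the optimal rate \<open>k r\<close>, but it is singular on the positive
  \<open>x\<close>-axis; its regularisation is \<open>F = r\<^sup>4\<^sup>k (1 + N)\<^sup>-\<^sup>k\<close>, where \<open>k = (5 \<delta> + 3) / 8\<close>. The bound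
  \<open>L F \<le> - c r F\<close> then fails only where \<open>N\<close> is bounded, that is, where \<open>x y\<^sup>2\<close> is bounded near the
  positive \<open>x\<close>-axis and the noise in \<open>y\<close> matters. There one adds a large multiple of
  \<open>G = r\<^sup>4\<^sup>k exp (- 5 N / (2 \<sigma>y))\<close>, a Gaussian in \<open>y \<surd>x\<close>, which satisfies
  \<open>L G \<approx> - (5/2 - 4 k) r G\<close>; the condition \<open>\<delta> < 2/5\<close> is exactly \<open>4 k < 5/2\<close>.\<close>

section \<open>Second-order jets\<close>

text \<open>A certificate carrying the derivatives as explicit functions: \<open>C2\<close> and the
  value of \<open>L\<close> are both read off it, and the calculus rules compute it mechanically.
  One \<open>fxy\<close> serves for both mixed derivatives, so their equality is checked
  directly.\<close>

definition has_jet ::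
  "(real \<times> real \<Rightarrow> real) \<Rightarrow> (real \<times> real \<Rightarrow> real) \<Rightarrow> (real \<times> real \<Rightarrow> real) \<Rightarrow>
   (real \<times> real \<Rightarrow> real) \<Rightarrow> (real \<times> real \<Rightarrow> real) \<Rightarrow> (real \<times> real \<Rightarrow> real) \<Rightarrow> bool" where
  "has_jet f fx fy fxx fxy fyy \<longleftrightarrow>
     continuous_on UNIV f \<and> continuous_on UNIV fx \<and> continuous_on UNIV fy \<and>
     continuous_on UNIV fxx \<and> continuous_on UNIV fxy \<and> continuous_on UNIV fyy \<and>
     (\<forall>x y. ((\<lambda>t. f (t, y)) has_real_derivative fx (x, y)) (at x)) \<and>
     (\<forall>x y. ((\<lambda>t. f (x, t)) has_real_derivative fy (x, y)) (at y)) \<and>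
     (\<forall>x y. ((\<lambda>t. fx (t, y)) has_real_derivative fxx (x, y)) (at x)) \<and>
     (\<forall>x y. ((\<lambda>t. fx (x, t)) has_real_derivative fxy (x, y)) (at y)) \<and>
     (\<forall>x y. ((\<lambda>t. fy (t, y)) has_real_derivative fxy (x, y)) (at x)) \<and>
     (\<forall>x y. ((\<lambda>t. fy (x, t)) has_real_derivative fyy (x, y)) (at y))"

lemma has_jetD:
  assumes "has_jet f fx fy fxx fxy fyy"
  shows "continuous_on UNIV f" "continuous_on UNIV fx" "continuous_on UNIV fy"
    "continuous_on UNIV fxx" "continuous_on UNIV fxy" "continuous_on UNIV fyy"
    "((\<lambda>t. f (t, y)) has_real_derivative fx (x, y)) (at x)"
    "((\<lambda>t. f (x, t)) has_real_derivative fy (x, y)) (at y)"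
    "((\<lambda>t. fx (t, y)) has_real_derivative fxx (x, y)) (at x)"
    "((\<lambda>t. fx (x, t)) has_real_derivative fxy (x, y)) (at y)"
    "((\<lambda>t. fy (t, y)) has_real_derivative fxy (x, y)) (at x)"
    "((\<lambda>t. fy (x, t)) has_real_derivative fyy (x, y)) (at y)"
  using assms unfolding has_jet_def by blast+

lemma has_jet_partials:
  assumes "has_jet f fx fy fxx fxy fyy"
  shows "partial_x f = fx" "partial_y f = fy"
    "partial_x fx = fxx" "partial_y fx = fxy" "partial_x fy = fxy" "partial_y fy = fyy"
  using assms unfolding has_jet_def partial_x_def partial_y_def
  by (auto simp: fun_eq_iff intro!: DERIV_imp_deriv)

lemma has_jet_C2:
  assumes "has_jet f fx fy fxx fxy fyy"
  shows "C2 f"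
  using assms unfolding C2_def C1_def has_jet_partials[OF assms] has_jet_def
  by (simp add: real_differentiable_def) blast

lemma L_has_jet:
  assumes "has_jet f fx fy fxx fxy fyy"
  shows "L \<sigma>x \<sigma>y f = (\<lambda>(x, y). (x\<^sup>2 - y\<^sup>2) * fx (x, y) + 2 * x * y * fy (x, y)
           + \<sigma>x * fxx (x, y) + \<sigma>y * fyy (x, y))"
  unfolding L_def has_jet_partials[OF assms] ..

lemma L_has_jet_continuous:
  assumes "has_jet f fx fy fxx fxy fyy"
  shows "continuous_on UNIV (L \<sigma>x \<sigma>y f)"
  using assms unfolding L_has_jet[OF assms] has_jet_def case_prod_unfold
  by (auto intro!: continuous_intros)

section \<open>Jet calculus: constants, coordinates, sums, products, compositions\<close>

lemma has_jet_const: "has_jet (\<lambda>_. c) (\<lambda>_. 0) (\<lambda>_. 0) (\<lambda>_. 0) (\<lambda>_. 0) (\<lambda>_. 0)"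
  by (auto simp: has_jet_def)

lemma has_jet_fst: "has_jet fst (\<lambda>_. 1) (\<lambda>_. 0) (\<lambda>_. 0) (\<lambda>_. 0) (\<lambda>_. 0)"
  by (auto simp: has_jet_def intro: continuous_on_fst continuous_on_id)

lemma has_jet_snd: "has_jet snd (\<lambda>_. 0) (\<lambda>_. 1) (\<lambda>_. 0) (\<lambda>_. 0) (\<lambda>_. 0)"
  by (auto simp: has_jet_def intro: continuous_on_snd continuous_on_id)

lemma has_jet_add:
  assumes "has_jet f fx fy fxx fxy fyy" "has_jet g gx gy gxx gxy gyy"
  shows "has_jet (\<lambda>p. f p + g p) (\<lambda>p. fx p + gx p) (\<lambda>p. fy p + gy p)
     (\<lambda>p. fxx p + gxx p) (\<lambda>p. fxy p + gxy p) (\<lambda>p. fyy p + gyy p)"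
  using assms unfolding has_jet_def by (auto intro!: continuous_intros DERIV_add)

lemma has_jet_mult:
  assumes f: "has_jet f fx fy fxx fxy fyy" and g: "has_jet g gx gy gxx gxy gyy"
  shows "has_jet (\<lambda>p. f p * g p) (\<lambda>p. fx p * g p + f p * gx p) (\<lambda>p. fy p * g p + f p * gy p)
     (\<lambda>p. fxx p * g p + 2 * fx p * gx p + f p * gxx p)
     (\<lambda>p. fxy p * g p + fx p * gy p + fy p * gx p + f p * gxy p)
     (\<lambda>p. fyy p * g p + 2 * fy p * gy p + f p * gyy p)"
proof -
  note F = has_jetD[OF f] and G = has_jetD[OF g]
  note D = DERIV_mult[THEN DERIV_cong] DERIV_add[OF DERIV_mult DERIV_mult, THEN DERIV_cong]
  show ?thesis
    unfolding has_jet_def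
    apply (intro conjI allI)
               apply (intro continuous_intros F G)+
         apply (rule D; (rule F G)?; simp add: algebra_simps)+
    done
qed

lemma has_jet_cmult:
  assumes "has_jet f fx fy fxx fxy fyy"
  shows "has_jet (\<lambda>p. c * f p) (\<lambda>p. c * fx p) (\<lambda>p. c * fy p)
     (\<lambda>p. c * fxx p) (\<lambda>p. c * fxy p) (\<lambda>p. c * fyy p)"
  using has_jet_mult[OF has_jet_const assms] by simp

text \<open>\<open>\<phi>\<close> has to be differentiable only at the values of \<open>f\<close>,
  so that functions such as \<open>ln (1 + t)\<close>, defined for \<open>t > -1\<close>, are
  admissible.\<close>

lemma has_jet_compose:
  assumes "has_jet f fx fy fxx fxy fyy"
    and "\<And>p. (\<phi> has_real_derivative \<phi>' (f p)) (at (f p))"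
    and "\<And>p. (\<phi>' has_real_derivative \<phi>'' (f p)) (at (f p))"
    and "continuous_on (range f) \<phi>''"
  shows "has_jet (\<lambda>p. \<phi> (f p)) (\<lambda>p. \<phi>' (f p) * fx p) (\<lambda>p. \<phi>' (f p) * fy p)
     (\<lambda>p. \<phi>'' (f p) * (fx p)\<^sup>2 + \<phi>' (f p) * fxx p)
     (\<lambda>p. \<phi>'' (f p) * fx p * fy p + \<phi>' (f p) * fxy p)
     (\<lambda>p. \<phi>'' (f p) * (fy p)\<^sup>2 + \<phi>' (f p) * fyy p)"
proof -
  note F = has_jetD[OF assms(1)]
  have f: "isCont f p" for p
    using F(1) continuous_on_eq_continuous_at[OF open_UNIV] by blast
  have c0: "continuous_on UNIV (\<lambda>p. \<phi> (f p))" "continuous_on UNIV (\<lambda>p. \<phi>' (f p))"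
    unfolding continuous_on_eq_continuous_at[OF open_UNIV]
    using isCont_o2[OF f DERIV_isCont[OF assms(2)]] isCont_o2[OF f DERIV_isCont[OF assms(3)]]
    by blast+
  have c2: "continuous_on UNIV (\<lambda>p. \<phi>'' (f p))"
    using continuous_on_compose2[OF assms(4) F(1)] by blast
  \<comment> \<open>\<open>h\<close> stands for a coordinate line through the point, so one chain
    rule gives both partial derivatives.\<close>
  have D1: "((\<lambda>t. \<phi> (f (h t))) has_real_derivative \<phi>' (f (h z)) * d) (at z)"
    and D2: "((\<lambda>t. \<phi>' (f (h t))) has_real_derivative \<phi>'' (f (h z)) * d) (at z)"
    if "((\<lambda>t. f (h t)) has_real_derivative d) (at z)" for h :: "real \<Rightarrow> real \<times> real" and z d
    using DERIV_chain2[where f = \<phi> and g = "\<lambda>t. f (h t)", OF assms(2) that]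
      DERIV_chain2[where f = \<phi>' and g = "\<lambda>t. f (h t)", OF assms(3) that] by blast+
  note D = DERIV_mult[OF D2, THEN DERIV_cong]
  show ?thesis
    unfolding has_jet_def
    apply (intro conjI allI)
               apply (intro continuous_intros F c0 c2)+
         apply (rule D1, rule F)+
       apply (rule D; (rule F)?; simp add: algebra_simps power2_eq_square)+
    done
qed

lemma has_jet_exp:
  assumes "has_jet f fx fy fxx fxy fyy"
  shows "has_jet (\<lambda>p. exp (f p)) (\<lambda>p. exp (f p) * fx p) (\<lambda>p. exp (f p) * fy p)
     (\<lambda>p. exp (f p) * (fx p)\<^sup>2 + exp (f p) * fxx p)
     (\<lambda>p. exp (f p) * fx p * fy p + exp (f p) * fxy p)
     (\<lambda>p. exp (f p) * (fy p)\<^sup>2 + exp (f p) * fyy p)"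
  by (rule has_jet_compose[OF assms]) (auto intro!: DERIV_exp continuous_intros)

section \<open>Linearity of the generator\<close>

lemma L_has_jet_add:
  assumes "has_jet f fx fy fxx fxy fyy" "has_jet g gx gy gxx gxy gyy"
  shows "L \<sigma>x \<sigma>y (\<lambda>p. f p + g p) q = L \<sigma>x \<sigma>y f q + L \<sigma>x \<sigma>y g q"
  unfolding L_has_jet[OF has_jet_add[OF assms]] L_has_jet[OF assms(1)] L_has_jet[OF assms(2)]
  by (simp add: case_prod_unfold algebra_simps)

lemma L_has_jet_cmult:
  assumes "has_jet f fx fy fxx fxy fyy"
  shows "L \<sigma>x \<sigma>y (\<lambda>p. c * f p) q = c * L \<sigma>x \<sigma>y f q"
  unfolding L_has_jet[OF has_jet_cmult[OF assms]] L_has_jet[OF assms]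
  by (simp add: case_prod_unfold algebra_simps)

text \<open>The quadratic branch is the second Taylor polynomial of \<open>ln t / 2\<close> at \<open>1\<close>, which makes
  \<open>hlog (x\<^sup>2 + y\<^sup>2)\<close> a \<open>C\<^sup>2\<close> version of \<open>ln |(x, y)|\<close> without the singularity at the origin.\<close>

definition hlog :: "real \<Rightarrow> real" where
  "hlog t = (if t \<ge> 1 then ln t / 2 else (t - 1) / 2 - (t - 1)\<^sup>2 / 4)"

definition hlog' :: "real \<Rightarrow> real" where
  "hlog' t = (if t \<ge> 1 then 1 / (2 * t) else 1 - t / 2)"

definition hlog'' :: "real \<Rightarrow> real" where
  "hlog'' t = (if t \<ge> 1 then - 1 / (2 * t\<^sup>2) else - 1 / 2)"

text \<open>Off the seam, one branch coincides with the glued function near the point. At the seam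
  both one-sided derivatives equal \<open>f' a\<close>, and the two closed half-lines cover the
  line.\<close>

lemma DERIV_If_ge:
  fixes f g :: "real \<Rightarrow> real"
  assumes "\<And>t. t \<ge> a \<Longrightarrow> (f has_real_derivative f' t) (at t)"
    and "\<And>t. t \<le> a \<Longrightarrow> (g has_real_derivative g' t) (at t)"
    and "f a = g a" "f' a = g' a"
  shows "((\<lambda>t. if t \<ge> a then f t else g t) has_real_derivative (if t \<ge> a then f' t else g' t)) (at t)"
proof -
  consider "t > a" | "t < a" | "t = a" by linarith
  then show ?thesis
  proof cases
    case 1
    have "eventually (\<lambda>t. t \<in> {a<..}) (nhds t)"
      using 1 by (intro eventually_nhds_in_open) auto
    then have "eventually (\<lambda>t. f t = (if t \<ge> a then f t else g t)) (nhds t)"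
      by eventually_elim auto
    with assms(1)[of t] 1 show ?thesis
      by (simp add: DERIV_cong_ev[OF refl _ refl])
  next
    case 2
    have "eventually (\<lambda>t. t \<in> {..<a}) (nhds t)"
      using 2 by (intro eventually_nhds_in_open) auto
    then have "eventually (\<lambda>t. g t = (if t \<ge> a then f t else g t)) (nhds t)"
      by eventually_elim auto
    with assms(2)[of t] 2 show ?thesis
      by (simp add: DERIV_cong_ev[OF refl _ refl])
  next
    case 3
    have "((\<lambda>t. if t \<ge> a then f t else g t) has_real_derivative f' a) (at a within {a..})"
      by (rule has_field_derivative_transform_within[of f _ _ _ 1])
        (auto intro: has_field_derivative_at_within assms)
    moreover have "((\<lambda>t. if t \<ge> a then f t else g t) has_real_derivative f' a) (at a within {..a})"
      by (rule has_field_derivative_transform_within[of g _ _ _ 1])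
        (auto intro: has_field_derivative_at_within assms simp: assms(3,4))
    ultimately have "((\<lambda>t. if t \<ge> a then f t else g t) has_real_derivative f' a)
        (at a within ({a..} \<union> {..a}))"
      by (simp add: has_field_derivative_iff Lim_within_Un)
    moreover have "{a..} \<union> {..a} = UNIV" by auto
    ultimately show ?thesis using 3 by simp
  qed
qed

lemma DERIV_hlog: "(hlog has_real_derivative hlog' t) (at t)"
  unfolding hlog_def hlog'_def
  by (rule DERIV_If_ge) (auto intro!: derivative_eq_intros simp: field_simps)

lemma DERIV_hlog': "(hlog' has_real_derivative hlog'' t) (at t)"
  unfolding hlog'_def hlog''_def
  by (rule DERIV_If_ge) (auto intro!: derivative_eq_intros simp: field_simps power2_eq_square)

lemma continuous_on_hlog'': "continuous_on UNIV hlog''"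
proof -
  \<comment> \<open>Freezing the argument at 1 below the seam merges the branches: the constant
    \<open>- 1 / 2\<close> is the value of the upper branch at 1.\<close>
  have "hlog'' = (\<lambda>t. - 1 / (2 * (max t 1)\<^sup>2))"
    by (auto simp: hlog''_def max_def fun_eq_iff)
  moreover have "continuous_on UNIV (\<lambda>t::real. - 1 / (2 * (max t 1)\<^sup>2))"
    by (intro continuous_intros) (simp add: max_def)
  ultimately show ?thesis by metis
qed

section \<open>Estimates away from the origin\<close>

text \<open>The quantities are free real variables tied by equations, so that all estimates become
  real algebra; \<open>s\<close> vanishes exactly on the positive x-axis.\<close>

locale far_point =
  fixes x y r s N :: real
  assumes r1: "r \<ge> 1" and r2: "r\<^sup>2 = x\<^sup>2 + y\<^sup>2"
    and s_def: "s = r - x" and N_def: "N = r\<^sup>2 * s"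
begin

lemma abs_x_le: "\<bar>x\<bar> \<le> r"
proof -
  have "x\<^sup>2 \<le> r\<^sup>2" unfolding r2 by simp
  then have "\<bar>x\<bar> \<le> \<bar>r\<bar>" by (simp only: abs_le_square_iff)
  with r1 show ?thesis by simp
qed

lemma s_bounds: "0 \<le> s" "s \<le> 2 * r"
  using abs_x_le by (auto simp: s_def)

lemma y2_eq: "y\<^sup>2 = s * (r + x)"
  using r2 by (simp add: s_def power2_eq_square algebra_simps)

lemma y2_le: "y\<^sup>2 \<le> 2 * r * s"
  using mult_left_mono[of "r + x" "2 * r" s] abs_x_le s_bounds unfolding y2_eq
  by (auto simp: mult.commute)

lemma s_le_N: "s \<le> N"
  using mult_right_mono[of 1 "r\<^sup>2" s] r1 s_bounds by (simp add: N_def)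

lemma N_nonneg: "0 \<le> N"
  using s_bounds s_le_N by linarith

lemma N_le: "N \<le> 2 * r ^ 3"
  using mult_left_mono[of s "2 * r" "r\<^sup>2"] s_bounds
  by (simp add: N_def power2_eq_square power3_eq_cube)

end

section \<open>Bounds on the noise terms and on the two growth rates\<close>

locale far_point_noise = far_point +
  fixes \<sigma>x \<sigma>y :: real
  assumes \<sigma>: "\<sigma>x \<ge> 0" "\<sigma>y > 0"
begin

text \<open>With \<open>\<Gamma>(f, g) = \<sigma>x f\<^sub>x g\<^sub>x + \<sigma>y f\<^sub>y g\<^sub>y\<close> and \<open>L\<^sub>2\<close> the second-order part of \<open>L\<close>, these are
  \<open>L\<^sub>2 (ln r)\<close>, \<open>\<Gamma>(ln r, ln r)\<close>, \<open>\<Gamma>(ln r, N)\<close>, \<open>\<Gamma>(N, N)\<close> and \<open>L\<^sub>2 N\<close>.\<close>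

definition "L2l = \<sigma>x * (1 / r\<^sup>2 - 2 * x\<^sup>2 / r ^ 4) + \<sigma>y * (1 / r\<^sup>2 - 2 * y\<^sup>2 / r ^ 4)"
definition "Gll = \<sigma>x * (x / r\<^sup>2)\<^sup>2 + \<sigma>y * (y / r\<^sup>2)\<^sup>2"
definition "GlN = \<sigma>x * (x / r\<^sup>2) * (s * (2 * x - r)) + \<sigma>y * (y / r\<^sup>2) * (y * (3 * r - 2 * x))"
definition "GNN = \<sigma>x * (s * (2 * x - r))\<^sup>2 + \<sigma>y * (y * (3 * r - 2 * x))\<^sup>2"
definition "L2N = \<sigma>x * (3 * s\<^sup>2 / r) + \<sigma>y * (3 * r - 2 * x + 3 * y\<^sup>2 / r)"

text \<open>\<open>L F / F\<close> for \<open>F = r\<^sup>p exp (g N)\<close>, where \<open>g1\<close> and \<open>g2\<close> are the first two derivatives of \<open>g\<close>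
  at \<open>N\<close>.\<close>

definition "rate p g1 g2 = p * x + g1 * (N * (r + 4 * x)) + p * L2l + g1 * L2N
   + (g2 + g1\<^sup>2) * GNN + p\<^sup>2 * Gll + 2 * p * g1 * GlN"

lemma inv_r2_le: "1 / r\<^sup>2 \<le> 1"
  using r1 by simp

lemma L2l_le: "L2l \<le> \<sigma>x + \<sigma>y"
proof -
  have "1 / r\<^sup>2 - 2 * z\<^sup>2 / r ^ 4 \<le> 1" for z
    using inv_r2_le by (rule order_trans[rotated]) simp
  then show ?thesis
    unfolding L2l_def using \<sigma> by (intro add_mono) (simp_all add: mult_left_le)
qed

lemma Gll_le: "Gll \<le> \<sigma>x + \<sigma>y"
proof -
  have "(z / r\<^sup>2)\<^sup>2 \<le> 1" if "z\<^sup>2 \<le> r\<^sup>2" for z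
  proof -
    have "(z / r\<^sup>2)\<^sup>2 = z\<^sup>2 / r\<^sup>2 * (1 / r\<^sup>2)"
      by (simp add: power_divide power2_eq_square)
    also have "\<dots> \<le> 1 * 1"
      using that r1 inv_r2_le by (intro mult_mono) (auto simp: divide_le_eq)
    finally show ?thesis by simp
  qed
  then show ?thesis
    unfolding Gll_def using \<sigma> r2 by (intro add_mono) (simp_all add: mult_left_le)
qed

text \<open>A lower bound is what is required, since \<open>GlN\<close> enters \<open>rate\<close>
  with the factor \<open>g1\<close>, negative in both applications. The y-part is nonnegative
  because \<open>3 * r - 2 * x \<ge> r\<close>; the x-part keeps its factor \<open>s\<close>, which
  is bounded wherever \<open>N\<close> is.\<close>

lemma GlN_ge: "GlN \<ge> - (3 * \<sigma>x * s)"
proof -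
  have "\<bar>x / r\<^sup>2 * (2 * x - r)\<bar> \<le> 3"
  proof -
    have "\<bar>x * (2 * x - r)\<bar> \<le> r * (3 * r)"
      unfolding abs_mult using abs_x_le r1 by (intro mult_mono) auto
    moreover have "\<bar>x / r\<^sup>2 * (2 * x - r)\<bar> = \<bar>x * (2 * x - r)\<bar> / r\<^sup>2"
      by (simp add: abs_mult)
    ultimately show ?thesis using r1 by (simp add: divide_le_eq power2_eq_square)
  qed
  then have "- 3 \<le> x / r\<^sup>2 * (2 * x - r)" by linarith
  then have "(\<sigma>x * s) * (- 3) \<le> (\<sigma>x * s) * (x / r\<^sup>2 * (2 * x - r))"
    using \<sigma> s_bounds by (intro mult_left_mono mult_nonneg_nonneg)
  also have "\<dots> = \<sigma>x * (x / r\<^sup>2) * (s * (2 * x - r))" by (simp only: mult_ac)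
  finally have 1: "(\<sigma>x * s) * (- 3) \<le> \<dots>" .
  have "0 \<le> \<sigma>y * (3 * r - 2 * x) * (y\<^sup>2 / r\<^sup>2)"
    using \<sigma> r1 abs_x_le by (intro mult_nonneg_nonneg) auto
  also have "\<dots> = \<sigma>y * (y / r\<^sup>2) * (y * (3 * r - 2 * x))" by (simp add: power2_eq_square)
  finally have 2: "0 \<le> \<dots>" .
  have "(\<sigma>x * s) * (- 3) + 0 \<le> GlN" unfolding GlN_def by (intro add_mono 1 2)
  then show ?thesis by simp
qed

lemma GlN_ge': "GlN \<ge> - (6 * \<sigma>x * r)"
proof -
  have "3 * \<sigma>x * s \<le> 6 * \<sigma>x * r"
    using mult_left_mono[of s "2 * r" "3 * \<sigma>x"] s_bounds \<sigma> by auto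
  with GlN_ge show ?thesis by linarith
qed

text \<open>Both squares are of order \<open>r ^ 3 * s = r * N\<close>: \<open>s * s\<close> and
  \<open>y\<^sup>2\<close> are at most \<open>2 * r * s\<close>, and the linear factors are at most
  \<open>3 * r\<close> and \<open>5 * r\<close> in absolute value.\<close>

lemma GNN_le: "GNN \<le> 50 * (\<sigma>x + \<sigma>y) * (r * N)"
proof -
  have "(2 * x - r)\<^sup>2 \<le> (3 * r)\<^sup>2"
    using abs_x_le r1 by (intro power2_le_iff_abs_le[THEN iffD2]) auto
  then have "(s * (2 * x - r))\<^sup>2 \<le> (s * s) * (9 * r\<^sup>2)"
    unfolding power_mult_distrib by (intro mult_mono) (auto simp: power2_eq_square)
  also have "\<dots> \<le> (2 * r * s) * (9 * r\<^sup>2)"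
    using s_bounds by (intro mult_right_mono) auto
  also have "\<dots> = 18 * (r * N)"
    by (simp add: N_def power2_eq_square)
  also have "\<dots> \<le> 50 * (r * N)" using N_nonneg r1 by (intro mult_right_mono) auto
  finally have 1: "(s * (2 * x - r))\<^sup>2 \<le> 50 * (r * N)" .
  have "(3 * r - 2 * x)\<^sup>2 \<le> (5 * r)\<^sup>2"
    using abs_x_le r1 by (intro power2_le_iff_abs_le[THEN iffD2]) auto
  then have "(y * (3 * r - 2 * x))\<^sup>2 \<le> (2 * r * s) * (5 * r)\<^sup>2"
    unfolding power_mult_distrib[of y] using y2_le s_bounds r1 by (intro mult_mono) auto
  also have "\<dots> = 50 * (r * N)"
    by (simp add: N_def power2_eq_square)
  finally have 2: "(y * (3 * r - 2 * x))\<^sup>2 \<le> 50 * (r * N)" .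
  have "GNN \<le> \<sigma>x * (50 * (r * N)) + \<sigma>y * (50 * (r * N))"
    unfolding GNN_def using 1 2 \<sigma> by (intro add_mono mult_left_mono) auto
  then show ?thesis by (simp add: algebra_simps)
qed

text \<open>This is how the noise in \<open>y\<close> produces decay: with \<open>g1 < 0\<close> the
  term \<open>g1 * L2N\<close> stays of order \<open>- r\<close> even on the positive x-axis, where
  \<open>N = 0\<close> and the drift only pushes outwards.\<close>

lemma L2N_ge: "L2N \<ge> \<sigma>y * r"
proof -
  have "\<sigma>y * (3 * r - 2 * x + 3 * y\<^sup>2 / r) \<ge> \<sigma>y * r"
    using \<sigma> abs_x_le r1 by (intro mult_left_mono add_increasing2) auto
  moreover have "\<sigma>x * (3 * s\<^sup>2 / r) \<ge> 0" using \<sigma> r1 by simp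
  ultimately show ?thesis unfolding L2N_def by linarith
qed

lemma L2N_nonneg: "L2N \<ge> 0"
  using L2N_ge \<sigma> r1 by (meson mult_nonneg_nonneg order_trans less_imp_le zero_le_one)

text \<open>For bounded \<open>N\<close> the factor \<open>3 * r - 2 * x = r + 2 * s\<close> is
  close to \<open>r\<close>, which gives the leading coefficient 2. The constant 50 of
  \<open>GNN_le\<close> would be too large for the cancellation in
  \<open>rate_exp_sharp\<close>.\<close>

lemma GNN_sharp:
  assumes "N \<le> Q"
  shows "GNN \<le> 2 * \<sigma>y * r * N + (9 * \<sigma>x * Q\<^sup>2 + \<sigma>y * (8 * Q\<^sup>2 + 8 * Q ^ 3))"
proof -
  have rs: "r\<^sup>2 * s\<^sup>2 \<le> Q\<^sup>2"
  proof -
    have "r * s \<le> r * (r * s)"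
      using r1 s_bounds mult_right_mono[of 1 r "r * s"] by simp
    then have "r * s \<le> Q" using assms by (simp add: N_def power2_eq_square)
    then have "(r * s)\<^sup>2 \<le> Q\<^sup>2" using r1 s_bounds by (intro power_mono) auto
    then show ?thesis by (simp add: power_mult_distrib)
  qed
  have sQ: "s \<le> Q" using s_le_N assms by linarith
  have rs3: "r * s ^ 3 \<le> Q ^ 3"
  proof -
    have "r * s ^ 3 \<le> r * (r * s ^ 3)"
      using r1 s_bounds mult_right_mono[of 1 r "r * s ^ 3"] by simp
    also have "\<dots> = (r\<^sup>2 * s\<^sup>2) * s" by (simp add: power2_eq_square power3_eq_cube)
    also have "\<dots> \<le> Q\<^sup>2 * Q" using rs sQ s_bounds by (intro mult_mono) auto
    finally show ?thesis by (simp add: power2_eq_square power3_eq_cube)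
  qed
  have "(2 * x - r)\<^sup>2 \<le> (3 * r)\<^sup>2"
    using abs_x_le r1 by (intro power2_le_iff_abs_le[THEN iffD2]) auto
  then have "(s * (2 * x - r))\<^sup>2 \<le> s\<^sup>2 * (9 * r\<^sup>2)"
    unfolding power_mult_distrib[of s] by (intro mult_mono) (auto simp: power2_eq_square)
  also have "\<dots> = 9 * (r\<^sup>2 * s\<^sup>2)" by simp
  also have "\<dots> \<le> 9 * Q\<^sup>2" using rs by (intro mult_left_mono) auto
  finally have 1: "(s * (2 * x - r))\<^sup>2 \<le> 9 * Q\<^sup>2" .
  have "(y * (3 * r - 2 * x))\<^sup>2 \<le> (2 * r * s) * (r + 2 * s)\<^sup>2"
    unfolding power_mult_distrib[of y] using y2_le s_bounds r1
    by (intro mult_mono) (auto simp: s_def)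
  also have "\<dots> = 2 * r * N + 8 * (r\<^sup>2 * s\<^sup>2) + 8 * (r * s ^ 3)"
    by (simp add: N_def power2_eq_square power3_eq_cube algebra_simps)
  also have "\<dots> \<le> 2 * r * N + (8 * Q\<^sup>2 + 8 * Q ^ 3)" using rs rs3 by linarith
  finally have 2: "(y * (3 * r - 2 * x))\<^sup>2 \<le> 2 * r * N + (8 * Q\<^sup>2 + 8 * Q ^ 3)" .
  have "GNN \<le> \<sigma>x * (9 * Q\<^sup>2) + \<sigma>y * (2 * r * N + (8 * Q\<^sup>2 + 8 * Q ^ 3))"
    unfolding GNN_def using 1 2 \<sigma> by (intro add_mono mult_left_mono) auto
  then show ?thesis by (simp add: algebra_simps)
qed

text \<open>The case \<open>g = - k * ln (1 + N)\<close>. With \<open>p = 4 * k\<close> the terms in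
  \<open>x\<close> cancel up to \<open>k * (r + 4 * x) / (1 + N)\<close>, leaving
  \<open>- k * r\<close>; every other term is of order \<open>r / (1 + N)\<close> or
  bounded.\<close>

lemma rate_power:
  assumes k: "k > 0"
  shows "rate (4 * k) (- k / (1 + N)) (k / (1 + N)\<^sup>2)
    \<le> - k * r + (5 * k + 50 * (k + k\<^sup>2) * (\<sigma>x + \<sigma>y) + 48 * k\<^sup>2 * \<sigma>x) * (r / (1 + N))
       + (4 * k + 16 * k\<^sup>2) * (\<sigma>x + \<sigma>y)"
proof -
  have pos: "1 + N > 0" using N_nonneg by simp
  have "4 * k * x + - k / (1 + N) * (N * (r + 4 * x)) = - k * r + k * (r + 4 * x) / (1 + N)"
    using pos by (simp add: field_simps)
  also have "\<dots> \<le> - k * r + 5 * k * (r / (1 + N))"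
    using pos abs_x_le k mult_left_mono[of "r + 4 * x" "5 * r" k] by (auto simp: divide_right_mono)
  finally have 1: "4 * k * x + - k / (1 + N) * (N * (r + 4 * x)) \<le> \<dots>" .
  have 2: "4 * k * L2l \<le> 4 * k * (\<sigma>x + \<sigma>y)"
    using L2l_le k by (intro mult_left_mono) auto
  have 3: "- k / (1 + N) * L2N \<le> 0"
    using L2N_nonneg k pos by (simp add: mult_le_0_iff divide_le_0_iff)
  have "(k / (1 + N)\<^sup>2 + (- k / (1 + N))\<^sup>2) * GNN = (k + k\<^sup>2) / (1 + N)\<^sup>2 * GNN"
    by (simp add: power_divide add_divide_distrib)
  also have "\<dots> \<le> (k + k\<^sup>2) / (1 + N)\<^sup>2 * (50 * (\<sigma>x + \<sigma>y) * (r * (1 + N)))"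
    using k r1 \<sigma> by (intro mult_left_mono order_trans[OF GNN_le]) auto
  also have "\<dots> = 50 * (k + k\<^sup>2) * (\<sigma>x + \<sigma>y) * (r / (1 + N))"
    using pos by (simp add: power2_eq_square) (simp add: algebra_simps)
  finally have 4: "(k / (1 + N)\<^sup>2 + (- k / (1 + N))\<^sup>2) * GNN \<le> \<dots>" .
  have 5: "(4 * k)\<^sup>2 * Gll \<le> 16 * k\<^sup>2 * (\<sigma>x + \<sigma>y)"
    using Gll_le by (simp add: power_mult_distrib mult_left_mono)
  have "8 * k\<^sup>2 / (1 + N) * (- GlN) \<le> 8 * k\<^sup>2 / (1 + N) * (6 * \<sigma>x * r)"
    using GlN_ge' pos by (intro mult_left_mono) auto
  then have 6: "2 * (4 * k) * (- k / (1 + N)) * GlN \<le> 48 * k\<^sup>2 * \<sigma>x * (r / (1 + N))"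
    by (simp add: power2_eq_square mult_ac)
  have "rate (4 * k) (- k / (1 + N)) (k / (1 + N)\<^sup>2) =
      (4 * k * x + - k / (1 + N) * (N * (r + 4 * x))) + 4 * k * L2l + - k / (1 + N) * L2N
      + (k / (1 + N)\<^sup>2 + (- k / (1 + N))\<^sup>2) * GNN + (4 * k)\<^sup>2 * Gll
      + 2 * (4 * k) * (- k / (1 + N)) * GlN"
    unfolding rate_def by (simp only: add_ac)
  also have "\<dots> \<le> (- k * r + 5 * k * (r / (1 + N))) + 4 * k * (\<sigma>x + \<sigma>y) + 0
      + 50 * (k + k\<^sup>2) * (\<sigma>x + \<sigma>y) * (r / (1 + N)) + 16 * k\<^sup>2 * (\<sigma>x + \<sigma>y)
      + 48 * k\<^sup>2 * \<sigma>x * (r / (1 + N))"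
    by (intro add_mono 1 2 3 4 5 6)
  finally show ?thesis by (simp only: distrib_right add_ac add_0_right add_0_left)
qed

text \<open>Meant for large \<open>N\<close>, where growth is harmless: the weight
  \<open>exp (- a * N)\<close> outweighs the polynomial factor \<open>1 + N\<close>.\<close>

lemma rate_exp_crude:
  assumes p: "p > 0" and a: "a > 0"
  shows "rate p (- a) 0 \<le>
    (p + 3 * a + (p + p\<^sup>2) * (\<sigma>x + \<sigma>y) + 12 * p * a * \<sigma>x + 50 * a\<^sup>2 * (\<sigma>x + \<sigma>y)) * (r * (1 + N))"
    (is "_ \<le> (_ + _ + ?B + ?D + ?E) * _")
proof -
  let ?M = "r * (1 + N)"
  have rM: "r \<le> ?M" and rNM: "r * N \<le> ?M" and M1: "1 \<le> ?M"
    using r1 N_nonneg mult_mono[of 1 r 1 "1 + N"] by (auto simp: algebra_simps)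
  have 1: "p * x \<le> p * ?M" using p abs_x_le rM by (intro mult_left_mono) auto
  have "- (r + 4 * x) \<le> 3 * r" using abs_x_le by auto
  then have "(a * N) * (- (r + 4 * x)) \<le> (a * N) * (3 * r)"
    using a N_nonneg by (intro mult_left_mono) auto
  also have "\<dots> = 3 * a * (r * N)" by simp
  also have "\<dots> \<le> 3 * a * ?M" using a by (intro mult_left_mono rNM) auto
  finally have 2: "- a * (N * (r + 4 * x)) \<le> 3 * a * ?M" by (simp add: algebra_simps)
  have "p * L2l + p\<^sup>2 * Gll \<le> p * (\<sigma>x + \<sigma>y) + p\<^sup>2 * (\<sigma>x + \<sigma>y)"
    using p L2l_le Gll_le by (intro add_mono mult_left_mono) auto
  also have "\<dots> = ?B * 1" by (simp add: algebra_simps)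
  also have "\<dots> \<le> ?B * ?M"
    using p \<sigma> M1 by (intro mult_left_mono mult_nonneg_nonneg) auto
  finally have 3: "p * L2l + p\<^sup>2 * Gll \<le> ?B * ?M" .
  have "2 * p * (- a) * GlN = 2 * p * a * (- GlN)" by simp
  also have "\<dots> \<le> 2 * p * a * (6 * \<sigma>x * r)"
    using p a GlN_ge' by (intro mult_left_mono) auto
  also have "\<dots> = ?D * r" by simp
  also have "\<dots> \<le> ?D * ?M" using p a \<sigma> rM by (intro mult_left_mono) auto
  finally have 4: "2 * p * (- a) * GlN \<le> ?D * ?M" .
  have "a\<^sup>2 * GNN \<le> a\<^sup>2 * (50 * (\<sigma>x + \<sigma>y) * (r * N))"
    using GNN_le by (intro mult_left_mono) auto
  also have "\<dots> = ?E * (r * N)" by simp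
  also have "\<dots> \<le> ?E * ?M" using \<sigma> by (intro mult_left_mono rNM) auto
  finally have 5: "(0 + (- a)\<^sup>2) * GNN \<le> ?E * ?M" by simp
  have 6: "- a * L2N \<le> 0" using a L2N_nonneg by (simp add: mult_nonneg_nonpos2)
  have "rate p (- a) 0 = p * x + - a * (N * (r + 4 * x)) + (p * L2l + p\<^sup>2 * Gll)
      + 2 * p * (- a) * GlN + (0 + (- a)\<^sup>2) * GNN + - a * L2N"
    unfolding rate_def by (simp only: add_ac)
  also have "\<dots> \<le> p * ?M + 3 * a * ?M + ?B * ?M + ?D * ?M + ?E * ?M + 0"
    by (intro add_mono 1 2 3 4 5 6)
  finally show ?thesis by (simp only: distrib_right add_0_right)
qed

text \<open>The choice \<open>a = 5 / (2 \<sigma>y)\<close> makes the terms of order \<open>r N\<close> cancel.\<close>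

lemma rate_exp_sharp:
  assumes p: "p > 0" and a: "a = 5 / (2 * \<sigma>y)" and Q: "N \<le> Q"
  shows "rate p (- a) 0 \<le> - (5 / 2 - p) * r +
    (4 * a * Q\<^sup>2 + (p + p\<^sup>2) * (\<sigma>x + \<sigma>y) + 6 * p * a * \<sigma>x * Q
      + a\<^sup>2 * (9 * \<sigma>x * Q\<^sup>2 + \<sigma>y * (8 * Q\<^sup>2 + 8 * Q ^ 3)))"
proof -
  have a0: "a > 0" and a\<sigma>: "a * \<sigma>y = 5 / 2" using a \<sigma> by simp_all
  have sQ: "s \<le> Q" using s_le_N Q by linarith
  have 1: "p * x \<le> p * r" using p abs_x_le by (intro mult_left_mono) auto
  have "N * s \<le> Q * Q" using N_nonneg s_bounds sQ Q by (intro mult_mono) auto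
  then have "4 * a * (N * s) \<le> 4 * a * (Q * Q)" using a0 by (intro mult_left_mono) auto
  \<comment> \<open>Substituting \<open>x = r - s\<close> isolates \<open>- 5 * a * N * r\<close>,
    the part of order \<open>r * N\<close>; the remainder is bounded because \<open>N\<close> and
    \<open>s\<close> are at most \<open>Q\<close>.\<close>
  moreover have "- a * (N * (r + 4 * x)) = - 5 * a * N * r + 4 * a * (N * s)"
    by (simp add: s_def algebra_simps)
  ultimately have 2: "- a * (N * (r + 4 * x)) \<le> - 5 * a * N * r + 4 * a * Q\<^sup>2"
    by (simp add: power2_eq_square)
  have "p * L2l + p\<^sup>2 * Gll \<le> p * (\<sigma>x + \<sigma>y) + p\<^sup>2 * (\<sigma>x + \<sigma>y)"
    using p L2l_le Gll_le by (intro add_mono mult_left_mono) auto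
  then have 3: "p * L2l + p\<^sup>2 * Gll \<le> (p + p\<^sup>2) * (\<sigma>x + \<sigma>y)" by (simp only: distrib_right)
  have "2 * p * (- a) * GlN = 2 * p * a * (- GlN)" by simp
  also have "\<dots> \<le> 2 * p * a * (3 * \<sigma>x * s)"
    using p a0 GlN_ge by (intro mult_left_mono) auto
  also have "\<dots> = 6 * p * a * \<sigma>x * s" by simp
  also have "\<dots> \<le> 6 * p * a * \<sigma>x * Q" using p a0 \<sigma> sQ by (intro mult_left_mono) auto
  finally have 4: "2 * p * (- a) * GlN \<le> 6 * p * a * \<sigma>x * Q" .
  have "a\<^sup>2 * GNN \<le> a\<^sup>2 * (2 * \<sigma>y * r * N + (9 * \<sigma>x * Q\<^sup>2 + \<sigma>y * (8 * Q\<^sup>2 + 8 * Q ^ 3)))"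
    using GNN_sharp[OF Q] by (intro mult_left_mono) auto
  \<comment> \<open>With \<open>a * \<sigma>y = 5 / 2\<close> the leading coefficient becomes
    \<open>5 * a\<close>, opposite to that of the drift.\<close>
  also have "\<dots> = 2 * (a * \<sigma>y) * a * r * N + a\<^sup>2 * (9 * \<sigma>x * Q\<^sup>2 + \<sigma>y * (8 * Q\<^sup>2 + 8 * Q ^ 3))"
    by (simp add: power2_eq_square algebra_simps)
  finally have 5: "(0 + (- a)\<^sup>2) * GNN \<le>
      5 * a * N * r + a\<^sup>2 * (9 * \<sigma>x * Q\<^sup>2 + \<sigma>y * (8 * Q\<^sup>2 + 8 * Q ^ 3))"
    unfolding a\<sigma> by (simp add: mult_ac)
  \<comment> \<open>The rate \<open>a * \<sigma>y = 5 / 2\<close> gained here outweighs the radial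
    growth \<open>p * r\<close> exactly when \<open>p < 5 / 2\<close>.\<close>
  have "a * L2N \<ge> a * (\<sigma>y * r)" using a0 L2N_ge by (intro mult_left_mono) auto
  then have 6: "- a * L2N \<le> - (5 / 2) * r" using a\<sigma> by (simp add: mult.assoc[symmetric])
  have "rate p (- a) 0 = p * x + - a * (N * (r + 4 * x)) + (p * L2l + p\<^sup>2 * Gll)
      + - a * L2N + (0 + (- a)\<^sup>2) * GNN + 2 * p * (- a) * GlN"
    unfolding rate_def by (simp only: add_ac)
  also have "\<dots> \<le> p * r + (- 5 * a * N * r + 4 * a * Q\<^sup>2) + (p + p\<^sup>2) * (\<sigma>x + \<sigma>y)
     + - (5 / 2) * r + (5 * a * N * r + a\<^sup>2 * (9 * \<sigma>x * Q\<^sup>2 + \<sigma>y * (8 * Q\<^sup>2 + 8 * Q ^ 3)))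
     + 6 * p * a * \<sigma>x * Q"
    by (intro add_mono 1 2 3 4 5 6)
  also have "\<dots> = - (5 / 2 - p) * r +
    (4 * a * Q\<^sup>2 + (p + p\<^sup>2) * (\<sigma>x + \<sigma>y) + 6 * p * a * \<sigma>x * Q
      + a\<^sup>2 * (9 * \<sigma>x * Q\<^sup>2 + \<sigma>y * (8 * Q\<^sup>2 + 8 * Q ^ 3)))"
    by (simp add: left_diff_distrib)
  finally show ?thesis .
qed

end

section \<open>Combination of the two rates\<close>

text \<open>The common factor \<open>r powr (4 * k)\<close> is divided out. For
  \<open>N \<le> Q0\<close> the error of the first rate is paid by the decay of the second; for
  \<open>Q0 < N \<le> Q1\<close> both rates are negative; beyond \<open>Q1\<close> the growth of the
  second is exponentially small.\<close>

lemma drift_estimate: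
  fixes k \<sigma>x \<sigma>y a :: real
  assumes k: "0 < k" "k < 5 / 8" and \<sigma>: "\<sigma>x \<ge> 0" "\<sigma>y > 0" and a: "a = 5 / (2 * \<sigma>y)"
  obtains A r0 where "A > 0" "r0 \<ge> 1"
    "\<And>x y r s N. \<lbrakk>far_point_noise x y r s N \<sigma>x \<sigma>y; r \<ge> r0\<rbrakk> \<Longrightarrow>
       (1 + N) powr (- k) * far_point_noise.rate x y r s N \<sigma>x \<sigma>y (4 * k) (- k / (1 + N)) (k / (1 + N)\<^sup>2)
       + A * (exp (- a * N) * far_point_noise.rate x y r s N \<sigma>x \<sigma>y (4 * k) (- a) 0)
       \<le> - (k / 4) * r * (1 + N) powr (- k)"
proof -
  define p where "p = 4 * k"
  have p: "p > 0" "p < 5 / 2" using k by (auto simp: p_def)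
  have a0: "a > 0" using a \<sigma> by simp
  define \<epsilon> where "\<epsilon> = 5 / 2 - p"
  have \<epsilon>: "\<epsilon> > 0" using p by (simp add: \<epsilon>_def)
  define C1 where "C1 = 5 * k + 50 * (k + k\<^sup>2) * (\<sigma>x + \<sigma>y) + 48 * k\<^sup>2 * \<sigma>x"
  define C2 where "C2 = (4 * k + 16 * k\<^sup>2) * (\<sigma>x + \<sigma>y)"
  define K where "K = p + 3 * a + (p + p\<^sup>2) * (\<sigma>x + \<sigma>y) + 12 * p * a * \<sigma>x + 50 * a\<^sup>2 * (\<sigma>x + \<sigma>y)"
  \<comment> \<open>Chosen so that \<open>C1 / (1 + N) \<le> k / 4\<close> for
    \<open>N \<ge> Q0\<close>.\<close>
  define Q0 where "Q0 = 4 * C1 / k"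
  \<comment> \<open>For \<open>N \<le> Q0\<close> the weight \<open>exp (- a * N)\<close> is at
    least \<open>exp (- a * Q0)\<close>, and this value makes
    \<open>A * (\<epsilon> / 2) * exp (- a * Q0)\<close> equal to \<open>C1\<close>.\<close>
  define A where "A = 2 * C1 * exp (a * Q0) / \<epsilon>"
  have C1: "C1 > 0" unfolding C1_def using k \<sigma> by (intro add_pos_nonneg) auto
  have A: "A > 0" unfolding A_def using C1 \<epsilon> by simp
  \<comment> \<open>\<open>Q\<close> is chosen after \<open>A\<close>, so there is no circularity.
    One factor \<open>1 + t\<close> comes from the crude rate; the other leaves
    \<open>1 / (1 + N)\<close>, which is at most \<open>(1 + N) powr (- k)\<close> as
    \<open>k < 1\<close>.\<close>
  have "((\<lambda>t. A * K * ((1 + t)\<^sup>2 * exp (- a * t))) \<longlongrightarrow> 0) at_top"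
    using a0 by real_asymp
  then have "eventually (\<lambda>t. A * K * ((1 + t)\<^sup>2 * exp (- a * t)) < k / 4) at_top"
    using k by (intro order_tendstoD) auto
  then obtain Q where Q: "\<And>t. t \<ge> Q \<Longrightarrow> A * K * ((1 + t)\<^sup>2 * exp (- a * t)) < k / 4"
    by (auto simp: eventually_at_top_linorder)
  define Q1 where "Q1 = max Q Q0"
  define C3 where "C3 = 4 * a * Q1\<^sup>2 + (p + p\<^sup>2) * (\<sigma>x + \<sigma>y) + 6 * p * a * \<sigma>x * Q1
      + a\<^sup>2 * (9 * \<sigma>x * Q1\<^sup>2 + \<sigma>y * (8 * Q1\<^sup>2 + 8 * Q1 ^ 3))"
  \<comment> \<open>Beyond \<open>r0\<close> the bounded errors cost a quarter of the rate
    \<open>k * r\<close> and half of the rate \<open>\<epsilon> * r\<close>.\<close>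
  define r0 where "r0 = max 1 (max (4 * C2 / k) (2 * C3 / \<epsilon>))"
  show ?thesis
  proof (rule that[OF A, of r0])
    show "r0 \<ge> 1" by (simp add: r0_def)
    fix x y r s N
    assume "far_point_noise x y r s N \<sigma>x \<sigma>y" and r: "r \<ge> r0"
    interpret far_point_noise x y r s N \<sigma>x \<sigma>y by fact
    define G1 where "G1 = (1 + N) powr (- k)"
    define G2 where "G2 = exp (- a * N)"
    define u where "u = 1 + N"
    define X1 where "X1 = rate (4 * k) (- k / (1 + N)) (k / (1 + N)\<^sup>2)"
    define X2 where "X2 = rate (4 * k) (- a) 0"
    have u: "u \<ge> 1" using N_nonneg by (simp add: u_def)
    have G1: "G1 > 0" "G1 \<le> 1" "1 / u \<le> G1"
      using u k powr_mono[of "- 1" "- k" u] powr_mono[of "- k" 0 u]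
      by (auto simp: G1_def u_def powr_minus_divide)
    have G2: "G2 > 0" by (simp add: G2_def)
    have r0': "r > 0" using r1 by simp
    have "C2 \<le> k / 4 * r" "C3 \<le> \<epsilon> / 2 * r"
      using r k \<epsilon> by (auto simp: r0_def field_simps)
    moreover have "X1 \<le> - k * r + C1 * (r / u) + C2"
      unfolding X1_def C1_def C2_def u_def by (rule rate_power[OF k(1)])
    ultimately have X1: "X1 \<le> - (3 * k / 4) * r + C1 * (r / u)" by simp
    have X2: "X2 \<le> - (\<epsilon> / 2) * r" if "N \<le> Q1"
    proof -
      have "X2 \<le> - \<epsilon> * r + C3"
        unfolding X2_def C3_def \<epsilon>_def using rate_exp_sharp[OF p(1) a that] by (simp only: p_def)
      then show ?thesis using \<open>C3 \<le> \<epsilon> / 2 * r\<close> by simp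
    qed
    have far: "X1 \<le> - (k / 2) * r" if "Q0 \<le> N"
    proof -
      have "C1 / u \<le> k / 4"
        using that u k C1 by (auto simp: Q0_def u_def field_simps)
      then have "C1 / u * r \<le> k / 4 * r" using r0' by (intro mult_right_mono) auto
      then have "C1 * (r / u) \<le> k / 4 * r" by simp
      with X1 show ?thesis by linarith
    qed
    have "G1 * X1 + A * (G2 * X2) \<le> - (k / 4) * r * G1"
    proof (cases "N \<le> Q0")
      case True
      have "G1 * X1 \<le> G1 * (- (3 * k / 4) * r + C1 * (r / u))"
        using X1 G1 by (intro mult_left_mono) auto
      also have "\<dots> = - (3 * k / 4) * r * G1 + C1 * (G1 * (r / u))"
        by (simp add: algebra_simps)
      also have "G1 * (r / u) \<le> 1 * r"
        using G1 u r0' by (intro mult_mono) (auto simp: field_simps)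
      finally have 1: "G1 * X1 \<le> - (3 * k / 4) * r * G1 + C1 * r" using C1 by simp
      have "exp (- a * Q0) \<le> G2" using True a0 by (simp add: G2_def)
      then have "A * (\<epsilon> / 2) * r * exp (- a * Q0) \<le> A * (\<epsilon> / 2) * r * G2"
        using A \<epsilon> r0' by (intro mult_left_mono) auto
      moreover have "A * (\<epsilon> / 2) * r * exp (- a * Q0) = C1 * r"
        using \<epsilon> by (simp add: A_def exp_minus)
      moreover have "A * (G2 * X2) \<le> A * (G2 * (- (\<epsilon> / 2) * r))"
        using A G2 X2 True by (intro mult_left_mono) (auto simp: Q1_def)
      moreover have "A * (G2 * (- (\<epsilon> / 2) * r)) = - (A * (\<epsilon> / 2) * r * G2)" by simp
      ultimately have 2: "A * (G2 * X2) \<le> - (C1 * r)" by linarith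
      have "0 \<le> k * r * G1" using k r0' G1 by simp
      with 1 2 show ?thesis by linarith
    next
      case False
      then have "G1 * X1 \<le> G1 * (- (k / 2) * r)"
        using far G1 by (intro mult_left_mono) auto
      then have 1: "G1 * X1 \<le> - (k / 2) * r * G1" by (simp add: mult_ac)
      have 2: "A * (G2 * X2) \<le> k / 4 * r * G1"
      proof (cases "N \<le> Q1")
        case True
        have "- (\<epsilon> / 2) * r \<le> 0" using \<epsilon> r0' by simp
        then have "X2 \<le> 0" using X2[OF True] by linarith
        then have "A * (G2 * X2) \<le> 0" using A G2 by (simp add: mult_le_0_iff)
        also have "0 \<le> k / 4 * r * G1" using k r0' G1 by simp
        finally show ?thesis .
      next
        case False
        have "A * (G2 * X2) \<le> A * (G2 * (K * (r * u)))"
          using A G2 rate_exp_crude[OF p(1) a0]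
          unfolding X2_def K_def u_def p_def by (intro mult_left_mono) auto
        also have "\<dots> = A * K * (u\<^sup>2 * G2) * (r * (1 / u))"
          using u by (simp add: power2_eq_square)
        also have "\<dots> \<le> k / 4 * (r * (1 / u))"
        proof (intro mult_right_mono)
          have "N \<ge> Q" using False by (simp add: Q1_def)
          then show "A * K * (u\<^sup>2 * G2) \<le> k / 4"
            using Q unfolding G2_def u_def by (intro less_imp_le)
        qed (use r0' u in auto)
        also have "\<dots> \<le> k / 4 * (r * G1)"
          using G1 r0' k by (intro mult_left_mono) auto
        finally show ?thesis by simp
      qed
      show ?thesis using 1 2 by simp
    qed
    then show "(1 + N) powr (- k) * rate (4 * k) (- k / (1 + N)) (k / (1 + N)\<^sup>2)
       + A * (exp (- a * N) * rate (4 * k) (- a) 0) \<le> - (k / 4) * r * (1 + N) powr (- k)"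
      by (simp only: G1_def G2_def X1_def X2_def)
  qed
qed

section \<open>The functions \<open>ln r\<close> and \<open>N\<close> on the whole plane\<close>

definition logr :: "real \<times> real \<Rightarrow> real" where
  "logr q = hlog ((fst q)\<^sup>2 + (snd q)\<^sup>2)"

text \<open>Written through \<open>logr\<close> to be \<open>C\<^sup>2\<close> at the origin too;
  for \<open>r \<ge> 1\<close> it is \<open>N = r ^ 3 - x * r\<^sup>2\<close>.\<close>

definition parab :: "real \<times> real \<Rightarrow> real" where
  "parab q = exp (3 * logr q) - fst q * exp (2 * logr q)"

lemma norm_pair_sq: "(norm (x, y))\<^sup>2 = x\<^sup>2 + y\<^sup>2" for x y :: real
  by (simp add: norm_Pair)

lemma one_le_norm_sq: "1 \<le> norm (x, y) \<Longrightarrow> 1 \<le> x\<^sup>2 + y\<^sup>2" for x y :: real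
  unfolding norm_pair_sq[symmetric] by simp

lemma logr_far: "1 \<le> norm q \<Longrightarrow> logr q = ln (norm q)"
  using one_le_norm_sq[of "fst q" "snd q"]
  by (simp add: logr_def hlog_def norm_prod_def ln_sqrt)

lemma parab_far:
  assumes "1 \<le> norm q"
  shows "parab q = (norm q)\<^sup>2 * (norm q - fst q)"
proof -
  have e: "exp (ln (norm q)) = norm q" using assms by (intro exp_ln) linarith
  have "exp (real n * ln (norm q)) = norm q ^ n" for n
    unfolding exp_of_nat_mult e ..
  from this[of 2] this[of 3] show ?thesis
    using assms by (simp add: parab_def logr_far power2_eq_square power3_eq_cube algebra_simps)
qed

lemma far_point_norm:
  assumes "1 \<le> norm (x, y)"
  shows "far_point x y (norm (x, y)) (norm (x, y) - x) (parab (x, y))"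
  using assms by unfold_locales (auto simp: norm_pair_sq parab_far)

text \<open>Makes \<open>ln (1 + parab q)\<close> smooth enough on the whole plane. Outside the unit
  disc \<open>N \<ge> 0\<close>; inside, \<open>logr q \<le> 0\<close> and \<open>fst q < 1\<close>
  bound the subtracted term by 1.\<close>

lemma one_plus_parab_pos: "1 + parab q > 0"
proof (cases "1 \<le> norm q")
  case True
  then interpret far_point "fst q" "snd q" "norm q" "norm q - fst q" "parab q"
    using far_point_norm[of "fst q" "snd q"] by simp
  show ?thesis using N_nonneg by simp
next
  case False
  then have "(norm q)\<^sup>2 < 1" by (simp add: power_less_one_iff abs_square_less_1)
  then have r: "(fst q)\<^sup>2 + (snd q)\<^sup>2 < 1" by (simp add: norm_prod_def)
  then have "(fst q)\<^sup>2 < 1" by (smt (verit) zero_le_power2)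
  then have x: "fst q < 1" by (simp add: abs_square_less_1)
  have "logr q \<le> 0"
    using r by (simp add: logr_def hlog_def) (smt (verit) zero_le_power2)
  then have e: "exp (2 * logr q) \<le> 1" by simp
  have "fst q * exp (2 * logr q) \<le> 1 * exp (2 * logr q)"
    using x by (intro mult_right_mono) auto
  with e have "fst q * exp (2 * logr q) \<le> 1" by linarith
  moreover have "exp (3 * logr q) > 0" by simp
  ultimately show ?thesis unfolding parab_def by linarith
qed

text \<open>Values are recorded for the derivatives occurring in \<open>L\<close> and for
  \<open>r \<ge> 1\<close>, where \<open>hlog\<close> is the true logarithm; inside the disc
  continuity and compactness do the work.\<close>

lemma has_jet_logr:
  obtains lx ly lxx lxy lyy where "has_jet logr lx ly lxx lxy lyy"
    "\<And>x y r. r = norm (x, y) \<Longrightarrow> 1 \<le> r \<Longrightarrow> lx (x, y) = x / r\<^sup>2 \<and> ly (x, y) = y / r\<^sup>2 \<and>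
       lxx (x, y) = 1 / r\<^sup>2 - 2 * x\<^sup>2 / r ^ 4 \<and> lyy (x, y) = 1 / r\<^sup>2 - 2 * y\<^sup>2 / r ^ 4"
proof -
  have J: "has_jet (\<lambda>q::real \<times> real. (fst q)\<^sup>2 + (snd q)\<^sup>2) (\<lambda>q. 2 * fst q) (\<lambda>q. 2 * snd q)
      (\<lambda>_. 2) (\<lambda>_. 0) (\<lambda>_. 2)"
    using has_jet_add[OF has_jet_mult[OF has_jet_fst has_jet_fst] has_jet_mult[OF has_jet_snd has_jet_snd]]
    by (simp add: power2_eq_square mult_2[symmetric])
  note K = has_jet_compose[OF J DERIV_hlog DERIV_hlog' continuous_on_subset[OF continuous_on_hlog'']]
  show ?thesis
  proof (rule that)
    show "has_jet logr (\<lambda>q. hlog' ((fst q)\<^sup>2 + (snd q)\<^sup>2) * (2 * fst q))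
      (\<lambda>q. hlog' ((fst q)\<^sup>2 + (snd q)\<^sup>2) * (2 * snd q))
      (\<lambda>q. hlog'' ((fst q)\<^sup>2 + (snd q)\<^sup>2) * (2 * fst q)\<^sup>2 + hlog' ((fst q)\<^sup>2 + (snd q)\<^sup>2) * 2)
      (\<lambda>q. hlog'' ((fst q)\<^sup>2 + (snd q)\<^sup>2) * (2 * fst q) * (2 * snd q) + hlog' ((fst q)\<^sup>2 + (snd q)\<^sup>2) * 0)
      (\<lambda>q. hlog'' ((fst q)\<^sup>2 + (snd q)\<^sup>2) * (2 * snd q)\<^sup>2 + hlog' ((fst q)\<^sup>2 + (snd q)\<^sup>2) * 2)"
      unfolding logr_def[abs_def] by (rule K) auto
  next
    fix x y r :: real
    assume r: "r = norm (x, y)" "1 \<le> r"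
    then have r2: "x\<^sup>2 + y\<^sup>2 = r\<^sup>2" by (simp add: norm_pair_sq)
    have "1 \<le> r\<^sup>2" using r(2) by simp
    then show "hlog' ((fst (x, y))\<^sup>2 + (snd (x, y))\<^sup>2) * (2 * fst (x, y)) = x / r\<^sup>2 \<and>
      hlog' ((fst (x, y))\<^sup>2 + (snd (x, y))\<^sup>2) * (2 * snd (x, y)) = y / r\<^sup>2 \<and>
      hlog'' ((fst (x, y))\<^sup>2 + (snd (x, y))\<^sup>2) * (2 * fst (x, y))\<^sup>2
        + hlog' ((fst (x, y))\<^sup>2 + (snd (x, y))\<^sup>2) * 2 = 1 / r\<^sup>2 - 2 * x\<^sup>2 / r ^ 4 \<and>
      hlog'' ((fst (x, y))\<^sup>2 + (snd (x, y))\<^sup>2) * (2 * snd (x, y))\<^sup>2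
        + hlog' ((fst (x, y))\<^sup>2 + (snd (x, y))\<^sup>2) * 2 = 1 / r\<^sup>2 - 2 * y\<^sup>2 / r ^ 4"
      unfolding fst_conv snd_conv r2 hlog'_def hlog''_def
      by (simp add: power_mult_distrib flip: power_mult)
  qed
qed

lemma has_jet_parab:
  obtains Nx Ny Nxx Nxy Nyy where "has_jet parab Nx Ny Nxx Nxy Nyy"
    "\<And>x y r s. r = norm (x, y) \<Longrightarrow> 1 \<le> r \<Longrightarrow> s = r - x \<Longrightarrow>
       Nx (x, y) = s * (2 * x - r) \<and> Ny (x, y) = y * (3 * r - 2 * x) \<and>
       Nxx (x, y) = 3 * s\<^sup>2 / r \<and> Nyy (x, y) = 3 * r - 2 * x + 3 * y\<^sup>2 / r"
proof -
  obtain lx ly lxx lxy lyy where l: "has_jet logr lx ly lxx lxy lyy"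
    and v: "\<And>x y r. r = norm (x, y) \<Longrightarrow> 1 \<le> r \<Longrightarrow> lx (x, y) = x / r\<^sup>2 \<and> ly (x, y) = y / r\<^sup>2 \<and>
       lxx (x, y) = 1 / r\<^sup>2 - 2 * x\<^sup>2 / r ^ 4 \<and> lyy (x, y) = 1 / r\<^sup>2 - 2 * y\<^sup>2 / r ^ 4"
    using has_jet_logr by metis
  note E = has_jet_exp[OF has_jet_cmult[OF l]]
  \<comment> \<open>The derivatives keep the raw shape produced by the product and chain rules and
    are simplified only on evaluation.\<close>
  have "has_jet parab
     (\<lambda>q. exp (3 * logr q) * (3 * lx q) + - 1 * (1 * exp (2 * logr q) + fst q * (exp (2 * logr q) * (2 * lx q))))
     (\<lambda>q. exp (3 * logr q) * (3 * ly q) + - 1 * (0 * exp (2 * logr q) + fst q * (exp (2 * logr q) * (2 * ly q))))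
     (\<lambda>q. exp (3 * logr q) * (3 * lx q)\<^sup>2 + exp (3 * logr q) * (3 * lxx q) +
        - 1 * (0 * exp (2 * logr q) + 2 * 1 * (exp (2 * logr q) * (2 * lx q)) +
          fst q * (exp (2 * logr q) * (2 * lx q)\<^sup>2 + exp (2 * logr q) * (2 * lxx q))))
     (\<lambda>q. exp (3 * logr q) * (3 * lx q) * (3 * ly q) + exp (3 * logr q) * (3 * lxy q) +
        - 1 * (0 * exp (2 * logr q) + 1 * (exp (2 * logr q) * (2 * ly q)) + 0 * (exp (2 * logr q) * (2 * lx q)) +
          fst q * (exp (2 * logr q) * (2 * lx q) * (2 * ly q) + exp (2 * logr q) * (2 * lxy q))))
     (\<lambda>q. exp (3 * logr q) * (3 * ly q)\<^sup>2 + exp (3 * logr q) * (3 * lyy q) +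
        - 1 * (0 * exp (2 * logr q) + 2 * 0 * (exp (2 * logr q) * (2 * ly q)) +
          fst q * (exp (2 * logr q) * (2 * ly q)\<^sup>2 + exp (2 * logr q) * (2 * lyy q))))"
    (is "has_jet _ ?Nx ?Ny ?Nxx ?Nxy ?Nyy")
    using has_jet_add[OF E[of 3] has_jet_cmult[OF has_jet_mult[OF has_jet_fst E[of 2]], of "- 1"]]
    by (simp add: parab_def[abs_def])
  then show ?thesis
  proof (rule that)
    fix x y r s :: real
    assume r: "r = norm (x, y)" "1 \<le> r" and s: "s = r - x"
    have r0: "r \<noteq> 0" using r by auto
    have y2: "y\<^sup>2 = r\<^sup>2 - x\<^sup>2" using r by (simp add: norm_pair_sq)
    have e: "exp (ln r) = r" using r(2) by (intro exp_ln) linarith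
    have "exp (real n * ln r) = r ^ n" for n
      unfolding exp_of_nat_mult e ..
    from this[of 2] this[of 3]
    have e: "exp (2 * logr (x, y)) = r\<^sup>2" "exp (3 * logr (x, y)) = r ^ 3"
      using r by (auto simp: logr_far)
    note v' = v[OF r, THEN conjunct1] v[OF r, THEN conjunct2, THEN conjunct1]
      v[OF r, THEN conjunct2, THEN conjunct2, THEN conjunct1]
      v[OF r, THEN conjunct2, THEN conjunct2, THEN conjunct2]
    have 1: "?Nx (x, y) = s * (2 * x - r)" "?Ny (x, y) = y * (3 * r - 2 * x)"
      unfolding v' e s fst_conv using r0
      by (simp_all add: field_simps power2_eq_square power3_eq_cube)
    have 2: "?Nxx (x, y) = 3 * s\<^sup>2 / r"
      unfolding v' e s fst_conv using r0
      by (simp add: field_simps eval_nat_numeral)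
    have "?Nyy (x, y) = 3 * r - 2 * x + 3 * y\<^sup>2 / r"
      unfolding v' e s fst_conv using r0
      by (simp add: field_simps eval_nat_numeral)
    with 1 2 show "?Nx (x, y) = s * (2 * x - r) \<and> ?Ny (x, y) = y * (3 * r - 2 * x) \<and>
       ?Nxx (x, y) = 3 * s\<^sup>2 / r \<and> ?Nyy (x, y) = 3 * r - 2 * x + 3 * y\<^sup>2 / r"
      by blast
  qed
qed

section \<open>The generator on exponentials of \<open>ln r\<close> and \<open>N\<close>\<close>

text \<open>For \<open>F = exp h\<close> one has \<open>L F / F = L h + \<Gamma>(h, h)\<close>;
  expanding this for \<open>h = p * ln r + g(N)\<close> gives \<open>rate\<close>. One computation
  thus serves the power weight and the Gaussian weight.\<close>

lemma L_exp_logr_parab: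
  fixes g g' g'' :: "real \<Rightarrow> real" and p \<sigma>x \<sigma>y :: real
  assumes g: "\<And>t. 1 + t > 0 \<Longrightarrow> (g has_real_derivative g' t) (at t)"
    and g': "\<And>t. 1 + t > 0 \<Longrightarrow> (g' has_real_derivative g'' t) (at t)"
    and g'': "continuous_on {-1<..} g''"
  defines "F \<equiv> \<lambda>q. exp (p * logr q + g (parab q))"
  obtains Fx Fy Fxx Fxy Fyy where "has_jet F Fx Fy Fxx Fxy Fyy"
    "\<And>x y. \<lbrakk>1 \<le> norm (x, y); \<sigma>x \<ge> 0; \<sigma>y > 0\<rbrakk> \<Longrightarrow>
      L \<sigma>x \<sigma>y F (x, y) = F (x, y) * far_point_noise.rate x y (norm (x, y)) (norm (x, y) - x)
         (parab (x, y)) \<sigma>x \<sigma>y p (g' (parab (x, y))) (g'' (parab (x, y)))"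
proof -
  obtain lx ly lxx lxy lyy where l: "has_jet logr lx ly lxx lxy lyy"
    and lv: "\<And>x y r. r = norm (x, y) \<Longrightarrow> 1 \<le> r \<Longrightarrow> lx (x, y) = x / r\<^sup>2 \<and> ly (x, y) = y / r\<^sup>2 \<and>
       lxx (x, y) = 1 / r\<^sup>2 - 2 * x\<^sup>2 / r ^ 4 \<and> lyy (x, y) = 1 / r\<^sup>2 - 2 * y\<^sup>2 / r ^ 4"
    using has_jet_logr by metis
  obtain Nx Ny Nxx Nxy Nyy where n: "has_jet parab Nx Ny Nxx Nxy Nyy"
    and nv: "\<And>x y r s. r = norm (x, y) \<Longrightarrow> 1 \<le> r \<Longrightarrow> s = r - x \<Longrightarrow>
       Nx (x, y) = s * (2 * x - r) \<and> Ny (x, y) = y * (3 * r - 2 * x) \<and>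
       Nxx (x, y) = 3 * s\<^sup>2 / r \<and> Nyy (x, y) = 3 * r - 2 * x + 3 * y\<^sup>2 / r"
    using has_jet_parab by metis
  have "- 1 < parab q" for q
    using one_plus_parab_pos[of q] by linarith
  then have c: "continuous_on (range parab) g''"
    by (intro continuous_on_subset[OF g'']) blast
  note J = has_jet_exp[OF has_jet_add[OF has_jet_cmult[OF l, of p]
        has_jet_compose[OF n g[OF one_plus_parab_pos] g'[OF one_plus_parab_pos] c]], folded F_def]
  show ?thesis
  proof (rule that[OF J])
    fix x y :: real
    assume r1: "1 \<le> norm (x, y)"
    assume \<sigma>: "\<sigma>x \<ge> 0" "\<sigma>y > 0"
    define r s where "r = norm (x, y)" and "s = r - x"
    define N where "N = parab (x, y)"
    note r = r_def and s = s_def and n = N_def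
    have r0: "r \<noteq> 0" using r1 by (auto simp: r_def)
    have N_eq: "N = r\<^sup>2 * (r - x)" using parab_far[OF r1] by (simp add: N_def r_def)
    interpret far_point_noise x y r s N \<sigma>x \<sigma>y
      using far_point_norm[OF r1] \<sigma>
      by (simp add: far_point_noise_def far_point_noise_axioms_def r_def s_def N_def)
    note lv' = lv[OF r_def r1[folded r_def]] and nv' = nv[OF r_def r1[folded r_def] s_def]
    have T1: "(x\<^sup>2 - y\<^sup>2) * (x / r\<^sup>2) + 2 * x * y * (y / r\<^sup>2) = x"
    proof -
      have "(x\<^sup>2 - y\<^sup>2) * (x / r\<^sup>2) + 2 * x * y * (y / r\<^sup>2) =
          ((x\<^sup>2 - y\<^sup>2) * x + 2 * x * y * y) / r\<^sup>2"
        by (simp only: add_divide_distrib times_divide_eq_right)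
      also have "(x\<^sup>2 - y\<^sup>2) * x + 2 * x * y * y = x * r\<^sup>2"
        unfolding r2 by (simp add: power2_eq_square algebra_simps)
      finally show ?thesis using r0 by simp
    qed
    \<comment> \<open>Since \<open>N = r ^ 4 * (s / r\<^sup>2)\<close>, the radial factor
      contributes the rate \<open>4 * x\<close> by \<open>T1\<close>, and
      \<open>s / r\<^sup>2\<close> the rate \<open>r\<close>.\<close>
    have T2: "(x\<^sup>2 - y\<^sup>2) * (s * (2 * x - r)) + 2 * x * y * (y * (3 * r - 2 * x)) = N * (r + 4 * x)"
    proof -
      have y: "y\<^sup>2 = r\<^sup>2 - x\<^sup>2" using r2 by simp
      have "2 * x * y * (y * (3 * r - 2 * x)) = 2 * x * y\<^sup>2 * (3 * r - 2 * x)"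
        by (simp add: power2_eq_square)
      then have "(x\<^sup>2 - y\<^sup>2) * (s * (2 * x - r)) + 2 * x * y * (y * (3 * r - 2 * x)) =
          (x\<^sup>2 - (r\<^sup>2 - x\<^sup>2)) * ((r - x) * (2 * x - r)) + 2 * x * (r\<^sup>2 - x\<^sup>2) * (3 * r - 2 * x)"
        unfolding y s by (simp only:)
      also have "\<dots> = r\<^sup>2 * (r - x) * (r + 4 * x)"
        by (simp add: power2_eq_square algebra_simps)
      finally show ?thesis unfolding N_eq .
    qed
    show "L \<sigma>x \<sigma>y F (x, y) = F (x, y) * far_point_noise.rate x y (norm (x, y)) (norm (x, y) - x)
         (parab (x, y)) \<sigma>x \<sigma>y p (g' (parab (x, y))) (g'' (parab (x, y)))"
    proof -
      let ?P = "p * (x / r\<^sup>2) + g' N * (s * (2 * x - r))"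
      let ?R = "p * (y / r\<^sup>2) + g' N * (y * (3 * r - 2 * x))"
      have "L \<sigma>x \<sigma>y F (x, y) =
        (x\<^sup>2 - y\<^sup>2) * (F (x, y) * ?P) + 2 * x * y * (F (x, y) * ?R)
        + \<sigma>x * (F (x, y) * ?P\<^sup>2 + F (x, y) * (p * (1 / r\<^sup>2 - 2 * x\<^sup>2 / r ^ 4)
            + (g'' N * (s * (2 * x - r))\<^sup>2 + g' N * (3 * s\<^sup>2 / r))))
        + \<sigma>y * (F (x, y) * ?R\<^sup>2 + F (x, y) * (p * (1 / r\<^sup>2 - 2 * y\<^sup>2 / r ^ 4)
            + (g'' N * (y * (3 * r - 2 * x))\<^sup>2 + g' N * (3 * r - 2 * x + 3 * y\<^sup>2 / r))))"
        unfolding L_has_jet[OF J] prod.case n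
        by (simp only: lv' nv' F_def)
      also have "\<dots> = F (x, y) * (p * ((x\<^sup>2 - y\<^sup>2) * (x / r\<^sup>2) + 2 * x * y * (y / r\<^sup>2))
          + g' N * ((x\<^sup>2 - y\<^sup>2) * (s * (2 * x - r)) + 2 * x * y * (y * (3 * r - 2 * x)))
          + p * L2l + g' N * L2N + (g'' N + (g' N)\<^sup>2) * GNN + p\<^sup>2 * Gll + 2 * p * g' N * GlN)"
        unfolding L2l_def L2N_def GNN_def Gll_def GlN_def by algebra
      also have "\<dots> = F (x, y) * rate p (g' N) (g'' N)"
        unfolding T1 T2 rate_def ..
      finally show ?thesis unfolding r s n .
    qed
  qed
qed

section \<open>The Lyapunov function\<close>

lemma super_lyapunov_exists:
  fixes \<sigma>x \<sigma>y \<delta> :: real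
  assumes \<sigma>: "\<sigma>x \<ge> 0" "\<sigma>y > 0" and \<delta>: "0 < \<delta>" "\<delta> < 2 / 5"
  shows "\<exists>V. super_lyapunov_function (L \<sigma>x \<sigma>y) ((5 * \<delta> + 5) / (5 * \<delta> + 3)) V \<and>
        (\<exists>c C. c > 0 \<and> C > 0 \<and>
          (\<forall>p::real \<times> real. norm p \<ge> 1 \<longrightarrow>
            c * norm p powr \<delta> \<le> V p \<and>
            V p \<le> C * norm p powr (5 / 2 * \<delta> + 3 / 2)))"
proof -
  \<comment> \<open>Fixed by the upper exponent \<open>4 * k = 5 / 2 * \<delta> + 3 / 2\<close>.
    Then \<open>\<gamma> - 1 = 1 / (4 * k)\<close>, and a function bounded by
    \<open>r powr (4 * k)\<close> has its power \<open>\<gamma> - 1\<close> bounded by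
    \<open>r\<close>, the available decay rate.\<close>
  define k where "k = (5 * \<delta> + 3) / 8"
  define \<gamma> where "\<gamma> = (5 * \<delta> + 5) / (5 * \<delta> + 3)"
  have k: "0 < k" "k < 5 / 8" "\<delta> \<le> k" using \<delta> by (auto simp: k_def)
  have \<gamma>: "\<gamma> > 1" "\<gamma> = 1 + 1 / (4 * k)" using \<delta> by (auto simp: \<gamma>_def k_def field_simps)
  have p: "5 / 2 * \<delta> + 3 / 2 = 4 * k" by (simp add: k_def)
  define a where "a = 5 / (2 * \<sigma>y)"
  have a: "a > 0" using \<sigma> by (simp add: a_def)
  obtain A r0 where A: "A > 0" and r0: "r0 \<ge> 1"
    and drift: "\<And>x y r s N. \<lbrakk>far_point_noise x y r s N \<sigma>x \<sigma>y; r \<ge> r0\<rbrakk> \<Longrightarrow>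
       (1 + N) powr (- k) * far_point_noise.rate x y r s N \<sigma>x \<sigma>y (4 * k) (- k / (1 + N)) (k / (1 + N)\<^sup>2)
       + A * (exp (- a * N) * far_point_noise.rate x y r s N \<sigma>x \<sigma>y (4 * k) (- a) 0)
       \<le> - (k / 4) * r * (1 + N) powr (- k)"
    using drift_estimate[OF k(1,2) \<sigma> a_def] by metis
  define F where "F = (\<lambda>q. exp (4 * k * logr q + - k * ln (1 + parab q)))"
  define G where "G = (\<lambda>q. exp (4 * k * logr q + - a * parab q))"
  obtain Fx Fy Fxx Fxy Fyy where F: "has_jet F Fx Fy Fxx Fxy Fyy"
    and LF: "\<And>x y. \<lbrakk>1 \<le> norm (x, y); \<sigma>x \<ge> 0; \<sigma>y > 0\<rbrakk> \<Longrightarrow>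
      L \<sigma>x \<sigma>y F (x, y) = F (x, y) * far_point_noise.rate x y (norm (x, y)) (norm (x, y) - x)
         (parab (x, y)) \<sigma>x \<sigma>y (4 * k) (- k / (1 + parab (x, y))) (k / (1 + parab (x, y))\<^sup>2)"
    unfolding F_def
  proof (rule L_exp_logr_parab[of "\<lambda>t. - k * ln (1 + t)" "\<lambda>t. - k / (1 + t)" "\<lambda>t. k / (1 + t)\<^sup>2"
        "4 * k" \<sigma>x \<sigma>y])
    show "((\<lambda>t. - k * ln (1 + t)) has_real_derivative - k / (1 + t)) (at t)" if "1 + t > 0" for t
      using that by (auto intro!: derivative_eq_intros)
    show "((\<lambda>t. - k / (1 + t)) has_real_derivative k / (1 + t)\<^sup>2) (at t)" if "1 + t > 0" for t
      using that by (auto intro!: derivative_eq_intros simp: power2_eq_square)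
    show "continuous_on {-1<..} (\<lambda>t. k / (1 + t)\<^sup>2)"
      by (auto intro!: continuous_intros)
  qed blast
  obtain Gx Gy Gxx Gxy Gyy where G: "has_jet G Gx Gy Gxx Gxy Gyy"
    and LG: "\<And>x y. \<lbrakk>1 \<le> norm (x, y); \<sigma>x \<ge> 0; \<sigma>y > 0\<rbrakk> \<Longrightarrow>
      L \<sigma>x \<sigma>y G (x, y) = G (x, y) * far_point_noise.rate x y (norm (x, y)) (norm (x, y) - x)
         (parab (x, y)) \<sigma>x \<sigma>y (4 * k) (- a) 0"
    unfolding G_def
  proof (rule L_exp_logr_parab[of "\<lambda>t. - a * t" "\<lambda>t. - a" "\<lambda>t. 0" "4 * k" \<sigma>x \<sigma>y])
    show "((\<lambda>t. - a * t) has_real_derivative - a) (at t)" for t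
      by (auto intro!: derivative_eq_intros)
  qed (auto intro!: continuous_intros)
  define V where "V = (\<lambda>q. 1 + (F q + A * G q))"
  note AG = has_jet_cmult[OF G, of A]
  note FG = has_jet_add[OF F AG]
  note V = has_jet_add[OF has_jet_const[of 1] FG, folded V_def]
  have pos: "F q > 0" "G q > 0" "V q > 0" for q
    using A by (auto simp: F_def G_def V_def intro!: add_pos_pos)
  have LV: "L \<sigma>x \<sigma>y V q = L \<sigma>x \<sigma>y F q + A * L \<sigma>x \<sigma>y G q" for q
  proof -
    have "L \<sigma>x \<sigma>y (\<lambda>_. 1) q = 0"
      by (simp add: L_has_jet[OF has_jet_const] case_prod_unfold)
    then show ?thesis
      unfolding V_def L_has_jet_add[OF has_jet_const FG] L_has_jet_add[OF F AG]
        L_has_jet_cmult[OF G] by simp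
  qed
  have N: "parab q \<ge> 0" "parab q \<le> 2 * norm q ^ 3" if "norm q \<ge> 1" for q
    using far_point.N_nonneg[OF far_point_norm[of "fst q" "snd q"]]
      far_point.N_le[OF far_point_norm[of "fst q" "snd q"]] that by auto
  have F_far: "F q = norm q powr (4 * k) * (1 + parab q) powr (- k)"
    and G_far: "G q = norm q powr (4 * k) * exp (- a * parab q)" if "norm q \<ge> 1" for q
    using that N(1)[OF that] by (auto simp: F_def G_def exp_add exp_diff powr_def logr_far exp_minus divide_inverse)
  \<comment> \<open>From \<open>1 + N \<le> 3 * r ^ 3\<close>: the factor
    \<open>(1 + N) powr (- k)\<close> loses at most \<open>r powr (3 * k)\<close> and this
    constant.\<close>
  define c where "c = 3 powr (- k)"
  have F_ge: "c * norm q powr k \<le> F q" if "norm q \<ge> 1" for q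
  proof -
    have "1 + parab q \<le> 3 * norm q ^ 3"
      using N(2)[OF that] one_le_power[OF that, of 3] by linarith
    then have "(3 * norm q ^ 3) powr (- k) \<le> (1 + parab q) powr (- k)"
      using N(1)[OF that] k by (intro powr_mono2') auto
    then have "norm q powr (4 * k) * (3 * norm q ^ 3) powr (- k) \<le> F q"
      unfolding F_far[OF that] by (intro mult_left_mono) auto
    moreover have "(3 * norm q ^ 3) powr (- k) = c * norm q powr (- 3 * k)"
      using that by (simp add: powr_mult c_def powr_powr flip: powr_numeral)
    moreover have "norm q powr (4 * k) * norm q powr (- 3 * k) = norm q powr k"
      by (simp flip: powr_add)
    ultimately show ?thesis by (simp add: mult_ac)
  qed
  have F_le: "F q \<le> norm q powr (4 * k)" if "norm q \<ge> 1" for q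
  proof -
    have "(1 + parab q) powr (- k) \<le> (1 + parab q) powr 0"
      using N(1)[OF that] k by (intro powr_mono) auto
    then have "(1 + parab q) powr (- k) \<le> 1" using N(1)[OF that] by simp
    then show ?thesis unfolding F_far[OF that] by (intro mult_left_le) auto
  qed
  \<comment> \<open>Makes \<open>e * (1 + N) \<le> 1 + a * N \<le> exp (a * N)\<close>, so the
    Gaussian weight is dominated by the power weight and \<open>V\<close> is comparable to
    \<open>F\<close>.\<close>
  define e where "e = min 1 a"
  have e: "e > 0" using a by (simp add: e_def)
  have G_le: "G q \<le> 1 / e * F q" if "norm q \<ge> 1" for q
  proof -
    have "e * (1 + parab q) \<le> 1 + a * parab q"
      using N(1)[OF that] by (auto simp: e_def distrib_left intro!: add_mono mult_right_mono)
    also have "\<dots> \<le> exp (a * parab q)" by (rule exp_ge_add_one_self)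
    finally have "inverse (exp (a * parab q)) \<le> inverse (e * (1 + parab q))"
      using N(1)[OF that] e by (intro le_imp_inverse_le mult_pos_pos) auto
    then have "exp (- a * parab q) \<le> 1 / (e * (1 + parab q))"
      by (simp add: exp_minus divide_inverse)
    also have "\<dots> = 1 / e * (1 + parab q) powr (- 1)"
      using N(1)[OF that] by (simp add: powr_minus_divide)
    also have "\<dots> \<le> 1 / e * (1 + parab q) powr (- k)"
      using N(1)[OF that] k e by (intro mult_left_mono powr_mono) auto
    finally have "norm q powr (4 * k) * exp (- a * parab q)
        \<le> norm q powr (4 * k) * (1 / e * (1 + parab q) powr (- k))"
      by (intro mult_left_mono) auto
    then show ?thesis unfolding F_far[OF that] G_far[OF that] by (simp add: mult_ac)
  qed
  \<comment> \<open>The summands bound the parts 1, \<open>F\<close> and \<open>A * G\<close> of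
    \<open>V\<close> by multiples of \<open>F\<close>; the first uses
    \<open>F \<ge> c\<close>.\<close>
  define C where "C = 1 / c + 1 + A * (1 / e)"
  have c0: "c > 0" by (simp add: c_def)
  have C: "C > 0" unfolding C_def using c0 A e by (intro add_pos_pos) auto
  have V_le: "V q \<le> C * F q" if "norm q \<ge> 1" for q
  proof -
    have "c * 1 \<le> c * norm q powr k"
      using c0 that k by (intro mult_left_mono ge_one_powr_ge_zero) auto
    then have "c \<le> F q" using F_ge[OF that] by simp
    then have "1 \<le> 1 / c * F q" using c0 by (simp add: field_simps)
    moreover have "A * G q \<le> A * (1 / e * F q)"
      using A G_le[OF that] by (intro mult_left_mono) auto
    ultimately show ?thesis unfolding V_def C_def by (simp add: distrib_right)
  qed
  have V_ge: "c * norm q powr \<delta> \<le> V q" if "norm q \<ge> 1" for q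
  proof -
    \<comment> \<open>The slowest growth is of order \<open>r powr k\<close>, seen on the negative
      x-axis where \<open>N = 2 * r ^ 3\<close>; it suffices because
      \<open>\<delta> \<le> k\<close>.\<close>
    have "c * norm q powr \<delta> \<le> c * norm q powr k"
      using c0 that k by (intro mult_left_mono powr_mono) auto
    also note F_ge[OF that]
    also have "F q \<le> V q" using A pos[of q] by (simp add: V_def add_increasing)
    finally show ?thesis .
  qed
  \<comment> \<open>Balances \<open>V powr \<gamma> \<le> C powr \<gamma> * (F * r)\<close> against
    \<open>L V \<le> - (k / 4) * (F * r)\<close>.\<close>
  define m where "m = k / 4 / C powr \<gamma>"
  have m: "m > 0" using k C by (simp add: m_def)
  have far: "L \<sigma>x \<sigma>y V q \<le> - m * V q powr \<gamma>" if q: "norm q \<ge> r0" for q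
  proof -
    obtain x y where xy: "q = (x, y)" by fastforce
    let ?r = "norm q" and ?N = "parab q"
    have r1: "?r \<ge> 1" using q r0 by linarith
    interpret far_point_noise x y ?r "?r - x" ?N \<sigma>x \<sigma>y
      using far_point_norm[of x y] r1 \<sigma> unfolding xy
      by (simp add: far_point_noise_def far_point_noise_axioms_def)
    have "L \<sigma>x \<sigma>y V q = F q * rate (4 * k) (- k / (1 + ?N)) (k / (1 + ?N)\<^sup>2)
        + A * (G q * rate (4 * k) (- a) 0)"
      using LF[of x y] LG[of x y] r1 \<sigma> unfolding LV xy by simp
    also have "\<dots> = ?r powr (4 * k) * ((1 + ?N) powr (- k) * rate (4 * k) (- k / (1 + ?N)) (k / (1 + ?N)\<^sup>2)
        + A * (exp (- a * ?N) * rate (4 * k) (- a) 0))"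
      unfolding F_far[OF r1] G_far[OF r1] by (simp only: distrib_left mult_ac)
    also have "\<dots> \<le> ?r powr (4 * k) * (- (k / 4) * ?r * (1 + ?N) powr (- k))"
      using q by (intro mult_left_mono drift far_point_noise_axioms) auto
    also have "\<dots> = - (k / 4) * (F q * ?r)"
      unfolding F_far[OF r1] by simp
    finally have 1: "L \<sigma>x \<sigma>y V q \<le> - (k / 4) * (F q * ?r)" .
    have "V q powr \<gamma> \<le> (C * F q) powr \<gamma>"
      using V_le[OF r1] \<gamma> pos[of q] by (intro powr_mono2) auto
    also have "\<dots> = C powr \<gamma> * (F q * F q powr (1 / (4 * k)))"
      using C pos[of q] unfolding \<gamma>(2) by (simp add: powr_mult powr_add)
    also have "\<dots> \<le> C powr \<gamma> * (F q * ?r)"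
    proof -
      have "F q powr (1 / (4 * k)) \<le> (?r powr (4 * k)) powr (1 / (4 * k))"
        using F_le[OF r1] pos[of q] k by (intro powr_mono2) auto
      also have "\<dots> = ?r" using k r1 by (simp add: powr_powr)
      finally show ?thesis using pos[of q] by (intro mult_left_mono) auto
    qed
    finally have "m * V q powr \<gamma> \<le> m * (C powr \<gamma> * (F q * ?r))"
      using m by (intro mult_left_mono) auto
    also have "\<dots> = k / 4 * (F q * ?r)" using C by (simp add: m_def)
    finally show ?thesis using 1 by simp
  qed
  have cont: "continuous_on UNIV (\<lambda>q. L \<sigma>x \<sigma>y V q + m * V q powr \<gamma>)"
    using pos(3) by (intro continuous_intros L_has_jet_continuous[OF V] has_jetD(1)[OF V])
      (auto simp: less_imp_neq[symmetric])
  \<comment> \<open>In the ball of radius \<open>r0\<close> the drift has no sign; a continuous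
    function on a compact set is bounded, which supplies \<open>b\<close>.\<close>
  have "bounded ((\<lambda>q. L \<sigma>x \<sigma>y V q + m * V q powr \<gamma>) ` cball 0 r0)"
    by (intro compact_imp_bounded compact_continuous_image continuous_on_subset[OF cont]) auto
  then obtain b where b: "b > 0" "\<And>q. norm q \<le> r0 \<Longrightarrow> \<bar>L \<sigma>x \<sigma>y V q + m * V q powr \<gamma>\<bar> \<le> b"
    by (auto simp: bounded_pos)
  have drift_all: "L \<sigma>x \<sigma>y V q \<le> - m * V q powr \<gamma> + b" for q
    using far[of q] b(1) b(2)[of q] by (cases "norm q \<le> r0") auto
  have lim: "filterlim V at_top at_infinity"
  proof (rule filterlim_at_top_mono)
    have "filterlim (\<lambda>t::real. c * t powr \<delta>) at_top at_top"
      using c0 \<delta> by real_asymp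
    then show "filterlim (\<lambda>q::real \<times> real. c * norm q powr \<delta>) at_top at_infinity"
      by (rule filterlim_compose[OF _ filterlim_norm_at_top])
    show "eventually (\<lambda>q. c * norm q powr \<delta> \<le> V q) at_infinity"
      unfolding eventually_at_infinity using V_ge by blast
  qed
  have "super_lyapunov_function (L \<sigma>x \<sigma>y) \<gamma> V"
    unfolding super_lyapunov_function_def lyapunov_function_def
    using \<gamma>(1) has_jet_C2[OF V] pos(3) lim m b(1) drift_all
    by (intro conjI exI[of _ m] exI[of _ b]) auto
  moreover have "V q \<le> C * norm q powr (4 * k)" if "norm q \<ge> 1" for q
    using V_le[OF that] mult_left_mono[OF F_le[OF that], of C] C by linarith
  ultimately show ?thesis
    unfolding p \<gamma>_def[symmetric] using c0 C V_ge by blast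
qed

theorem theorem1:
  fixes \<sigma>x \<sigma>y :: real
  assumes "\<sigma>x \<ge> 0" and "\<sigma>y > 0"
  shows "(\<exists>V \<gamma>. super_lyapunov_function (L \<sigma>x \<sigma>y) \<gamma> V) \<and>
    (\<forall>\<delta>::real. 0 < \<delta> \<and> \<delta> < 2 / 5 \<longrightarrow>
      (\<exists>V. super_lyapunov_function (L \<sigma>x \<sigma>y) ((5 * \<delta> + 5) / (5 * \<delta> + 3)) V \<and>
        (\<exists>c C. c > 0 \<and> C > 0 \<and>
          (\<forall>p::real \<times> real. norm p \<ge> 1 \<longrightarrow>
            c * norm p powr \<delta> \<le> V p \<and>
            V p \<le> C * norm p powr (5 / 2 * \<delta> + 3 / 2)))))"
proof (intro conjI allI impI)
  show "\<exists>V \<gamma>. super_lyapunov_function (L \<sigma>x \<sigma>y) \<gamma> V"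
    \<comment> \<open>Any \<delta> in the open interval serves here; \<open>1 / 5\<close> is its
      midpoint.\<close>
    using super_lyapunov_exists[OF assms, of "1 / 5"] by auto
qed (use super_lyapunov_exists[OF assms] in blast)

end
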